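(* Let $P$ be a tableau of shape $\beta/\alpha$ with entries from $[k]$ and $Q$ a tableau of shape $\delta/\beta$ with entries from $[k']$ (so $Q$ extends $P$), and let $l$ be at least the initial part of $\delta$. Let $Q^C$ be the complement of $Q$ with respect to $k',l$; after the vertical shift $P\mapsto(l^{k'},P)$, the tableaux $P$ and $Q^C$ share the outer border $(l^{k'},\beta)$. Let $(T',U')=\mathcal{R}(P,Q^C)$ be the result of internal row insertion (with parameter $l$), and let $\mathcal{J}(P,Q)=(T,U)$ be the result of the jeu de taquin. Then, identifying tableaux that differ by a vertical shift, $T=T'$ and $U=(U')^C$ (complement with respect to $k',l$). That is, the complement $\mathcal{R}^C$ of internal row insertion coincides with the jeu de taquin $\mathcal{J}$.
   Context: Partitions are weakly decreasing sequences of nonnegative integers indexed by intervals of integers, ordered componentwise; $\beta/\alpha$ is a horizontal strip if $\beta_i\geq\alpha_i\geq\beta_{i+1}$ for all $i$. A tableau of shape $\beta/\alpha$ with entries from $[k]$ is a chain $\alpha=\beta^0\subseteq\cdots\subseteq\beta^k=\beta$ with horizontal-strip differences (the boxes of $\beta^i/\beta^{i-1}$ hold $i$); tableaux differing by a vertical shift are identified; $(l^i,\gamma)$ denotes $\gamma$ with $i$ parts $l$ prepended, and $(l^i,P)$ applies this to every shape of $P$. Complement of $T:\beta^0\subseteq\cdots\subseteq\beta^k$ w.r.t. $k,l$: $T^C:\beta^k\subseteq(l,\beta^{k-1})\subseteq\cdots\subseteq(l^k,\beta^0)$. Growth diagram: rectangular array of partitions whose rows (left to right) and columns (top to bottom)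 are tableaux, all rows of equal content and all columns of equal content. Local rule $\mathcal{R}$: for $\alpha,\beta,\gamma$ with $\beta/\alpha,\gamma/\alpha$ horizontal strips, all with initial ($m$th) part equal to $l$ (prepend $l$ if necessary), $\delta=\mathcal{R}(\alpha;\beta,\gamma)$ has $\delta_m=l$ and $\delta_i=\max\{\beta_i,\gamma_i\}+\min\{\beta_{i-1},\gamma_{i-1}\}-\alpha_{i-1}$ for $i>m$; conversely, given $\beta,\gamma,\delta$ (with initial parts $l$) there is a unique $\alpha$ with $\mathcal{R}(\alpha;\beta,\gamma)=\delta$. Internal row insertion: for tableaux $P,Q$ sharing an outer border, write $P$ across the last row and $Q$ down the last column of a rectangular array and complete it to a growth diagram by repeatedly determining the upper-left corner $\alpha$ of a $2\times 2$ square from $\beta$ (upper right), $\gamma$ (lower left), $\delta$ (lower right) via $\mathcal{R}$; then $\mathcal{R}(P,Q)=(T,U)$ with $T$ the first row and $U$ the first column (for $P,Q$ sharing an inner border one writes them across the first row and down the first column and takes the last row and last column). Jeu de taquin $\mathcal{J}$: a jeu de taquin slide into an inner corner moves the empty box, interchanging it repeatedly with its right or lower neighbour (the smaller one, the lower one if equal) keeping rows weakly and columns strictly increasing, until it reaches an outer corner. The standard renumbering of $P$ numbers the boxes of each horizontal strip $\beta^i/\beta^{i-1}$ from left to right, strips in increasing order of $i$. For $Q$ extending $P$, perform slides on $Q$ successively into the boxes of $P$ in decreasing order of standard renumbering; $U$ is the resulting tableau (with inner border $\alpha$) and $T$ is the tableau with outer border $\delta$ whose boxes are the outer corners vacated,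 the box vacated by the slide into a box of $P$ receiving that box's entry in $P$. Then $\mathcal{J}(P,Q)=(T,U)$. *)

theory Defs
  imports Main "HOL-Library.While_Combinator"
begin

text \<open>
  A partition indexed from \<open>m = start \<gamma>\<close> on. Parts to the right of the last index are read as 0, so
  partitions differing only in trailing zeros are equal. Values at indices below \<open>start \<gamma>\<close> carry no
  meaning and are fixed to 0.
\<close>

datatype partn = Partn (start: int) (part: "int \<Rightarrow> nat")

definition is_partition :: "partn \<Rightarrow> bool" where
  "is_partition \<gamma> \<longleftrightarrow>
     (\<forall>i < start \<gamma>. part \<gamma> i = 0) \<and>
     (\<forall>i \<ge> start \<gamma>. part \<gamma> (i + 1) \<le> part \<gamma> i) \<and>
     finite {i. part \<gamma> i \<noteq> 0}"

definition initial_part :: "partn \<Rightarrow> nat" where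
  "initial_part \<gamma> = part \<gamma> (start \<gamma>)"

definition horizontal_strip :: "partn \<Rightarrow> partn \<Rightarrow> bool" where
  "horizontal_strip \<alpha> \<beta> \<longleftrightarrow>
     start \<alpha> = start \<beta> \<and>
     (\<forall>i \<ge> start \<beta>. part \<alpha> i \<le> part \<beta> i \<and> part \<beta> (i + 1) \<le> part \<alpha> i)"

text \<open>
  \<open>tableau k \<alpha> \<beta> S\<close>: the chain \<open>S = [\<beta>\<^sup>0, \<dots>, \<beta>\<^sup>k]\<close> is a tableau of shape \<open>\<beta>/\<alpha>\<close> with entries from \<open>[k]\<close>.
\<close>

definition tableau :: "nat \<Rightarrow> partn \<Rightarrow> partn \<Rightarrow> partn list \<Rightarrow> bool" where
  "tableau k \<alpha> \<beta> S \<longleftrightarrow>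
     length S = Suc k \<and> hd S = \<alpha> \<and> last S = \<beta> \<and>
     (\<forall>\<gamma> \<in> set S. is_partition \<gamma>) \<and>
     (\<forall>i < k. horizontal_strip (S ! i) (S ! Suc i))"

text \<open>Boxes are pairs (row, column); the columns are numbered from 1.\<close>

definition skew_boxes :: "partn \<Rightarrow> partn \<Rightarrow> (int \<times> nat) set" where
  "skew_boxes \<alpha> \<beta> = {(i, j). part \<alpha> i < j \<and> j \<le> part \<beta> i}"

definition content :: "partn list \<Rightarrow> nat list" where
  "content S = map (\<lambda>i. card (skew_boxes (S ! i) (S ! Suc i))) [0..<length S - 1]"

text \<open>
  \<open>prepend l i \<gamma>\<close> is \<open>(l\<^sup>i, \<gamma>)\<close>. The start index is kept and the parts of \<open>\<gamma>\<close> move down by \<open>i\<close> rows, as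
  needed for the chain \<open>\<beta>\<^sup>k \<subseteq> (l, \<beta>\<^sup>k\<^sup>-\<^sup>1) \<subseteq> \<dots>\<close> of a complement.
\<close>

definition prepend :: "nat \<Rightarrow> nat \<Rightarrow> partn \<Rightarrow> partn" where
  "prepend l i \<gamma> = Partn (start \<gamma>)
     (\<lambda>r. if r < start \<gamma> then 0 else if r < start \<gamma> + int i then l else part \<gamma> (r - int i))"

definition prepend_tableau :: "nat \<Rightarrow> nat \<Rightarrow> partn list \<Rightarrow> partn list" where
  "prepend_tableau l i S = map (prepend l i) S"

text \<open>
  Identification of tableaux up to vertical shift. As \<open>prepend\<close> keeps start indices, a shift by \<open>i\<close>
  rows amounts to prepending \<open>i\<close> parts \<open>l\<close> to all shapes.
\<close>

definition vshift_eq :: "nat \<Rightarrow> partn list \<Rightarrow> partn list \<Rightarrow> bool" where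
  "vshift_eq l S S' \<longleftrightarrow> (\<exists>i j. prepend_tableau l i S = prepend_tableau l j S')"

definition complement :: "nat \<Rightarrow> nat \<Rightarrow> partn list \<Rightarrow> partn list" where
  "complement k l S = map (\<lambda>i. prepend l i (S ! (k - i))) [0..<Suc k]"


subsection \<open>Internal row insertion\<close>

text \<open>
  When \<open>\<beta>/\<alpha>\<close> and \<open>\<gamma>/\<alpha>\<close> are horizontal strips, the subtraction below does not truncate.
\<close>

definition local_rule :: "nat \<Rightarrow> partn \<Rightarrow> partn \<Rightarrow> partn \<Rightarrow> partn" where
  "local_rule l \<alpha> \<beta> \<gamma> = Partn (start \<alpha>)
     (\<lambda>i. if i < start \<alpha> then 0
          else if i = start \<alpha> then l
          else max (part \<beta> i) (part \<gamma> i) + min (part \<beta> (i - 1)) (part \<gamma> (i - 1)) - part \<alpha> (i - 1))"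

definition local_square :: "nat \<Rightarrow> partn \<Rightarrow> partn \<Rightarrow> partn \<Rightarrow> partn \<Rightarrow> bool" where
  "local_square l \<alpha> \<beta> \<gamma> \<delta> \<longleftrightarrow>
     horizontal_strip \<alpha> \<beta> \<and> horizontal_strip \<alpha> \<gamma> \<and>
     initial_part \<alpha> = l \<and> initial_part \<beta> = l \<and> initial_part \<gamma> = l \<and>
     \<delta> = local_rule l \<alpha> \<beta> \<gamma>"

definition array_row :: "nat \<Rightarrow> (nat \<Rightarrow> nat \<Rightarrow> partn) \<Rightarrow> nat \<Rightarrow> partn list" where
  "array_row k G r = map (\<lambda>c. G r c) [0..<Suc k]"

definition array_col :: "nat \<Rightarrow> (nat \<Rightarrow> nat \<Rightarrow> partn) \<Rightarrow> nat \<Rightarrow> partn list" where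
  "array_col k' G c = map (\<lambda>r. G r c) [0..<Suc k']"

text \<open>The array has rows \<open>0, \<dots>, k'\<close> (top to bottom) and columns \<open>0, \<dots>, k\<close> (left to right).\<close>

definition growth_diagram :: "nat \<Rightarrow> nat \<Rightarrow> (nat \<Rightarrow> nat \<Rightarrow> partn) \<Rightarrow> bool" where
  "growth_diagram k k' G \<longleftrightarrow>
     (\<forall>r \<le> k'. tableau k (G r 0) (G r k) (array_row k G r)) \<and>
     (\<forall>c \<le> k. tableau k' (G 0 c) (G k' c) (array_col k' G c)) \<and>
     (\<forall>r \<le> k'. content (array_row k G r) = content (array_row k G 0)) \<and>
     (\<forall>c \<le> k. content (array_col k' G c) = content (array_col k' G 0))"

text \<open>
  \<open>row_insertion l k k' P Q T U\<close> states \<open>\<R>(P, Q) = (T, U)\<close> for \<open>P\<close>, \<open>Q\<close> sharing an outer border. The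
  number \<open>n\<close> accounts for prepending \<open>l\<close> where necessary to make all initial parts equal to \<open>l\<close>; hence
  \<open>T\<close> and \<open>U\<close> are only determined up to a vertical shift.
\<close>

definition row_insertion ::
    "nat \<Rightarrow> nat \<Rightarrow> nat \<Rightarrow> partn list \<Rightarrow> partn list \<Rightarrow> partn list \<Rightarrow> partn list \<Rightarrow> bool" where
  "row_insertion l k k' P Q T U \<longleftrightarrow>
     (\<exists>n G. growth_diagram k k' G \<and>
        (\<forall>r < k'. \<forall>c < k.
           local_square l (G r c) (G r (Suc c)) (G (Suc r) c) (G (Suc r) (Suc c))) \<and>
        array_row k G k' = prepend_tableau l n P \<and>
        array_col k' G k = prepend_tableau l n Q \<and>
        T = array_row k G 0 \<and>
        U = array_col k' G 0)"


subsection \<open>Jeu de taquin\<close>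

type_synonym filling = "int \<times> nat \<Rightarrow> nat option"

definition holds_entry :: "partn list \<Rightarrow> int \<times> nat \<Rightarrow> nat \<Rightarrow> bool" where
  "holds_entry S b i \<longleftrightarrow> 1 \<le> i \<and> i < length S \<and> b \<in> skew_boxes (S ! (i - 1)) (S ! i)"

definition filling_of :: "partn list \<Rightarrow> filling" where
  "filling_of S b = (if \<exists>i. holds_entry S b i then Some (THE i. holds_entry S b i) else None)"

definition right_of :: "int \<times> nat \<Rightarrow> int \<times> nat" where
  "right_of b = (fst b, snd b + 1)"

definition below :: "int \<times> nat \<Rightarrow> int \<times> nat" where
  "below b = (fst b + 1, snd b)"

definition move_into :: "filling \<Rightarrow> int \<times> nat \<Rightarrow> int \<times> nat \<Rightarrow> filling \<times> (int \<times> nat)" where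
  "move_into F b c = (F(b := F c, c := None), c)"

definition slide_step :: "filling \<times> (int \<times> nat) \<Rightarrow> filling \<times> (int \<times> nat)" where
  "slide_step = (\<lambda>(F, b).
     if below b \<in> dom F \<and> (right_of b \<in> dom F \<longrightarrow> the (F (below b)) \<le> the (F (right_of b)))
     then move_into F b (below b)
     else move_into F b (right_of b))"

text \<open>\<open>slide F b\<close> returns the new filling together with the vacated outer corner.\<close>

definition slide :: "filling \<Rightarrow> int \<times> nat \<Rightarrow> filling \<times> (int \<times> nat)" where
  "slide F b =
     while (\<lambda>(F, b). right_of b \<in> dom F \<or> below b \<in> dom F) slide_step (F, b)"

text \<open>Boxes of one horizontal strip lie in distinct columns, so this is a bijection onto \<open>{1..n}\<close>.\<close>

definition standard_number :: "partn list \<Rightarrow> int \<times> nat \<Rightarrow> nat" where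
  "standard_number P b = card {b' \<in> dom (filling_of P).
     the (filling_of P b') < the (filling_of P b) \<or>
     filling_of P b' = filling_of P b \<and> snd b' \<le> snd b}"

definition boxes_decreasing :: "partn list \<Rightarrow> (int \<times> nat) list" where
  "boxes_decreasing P =
     map (inv_into (dom (filling_of P)) (standard_number P))
         (rev [1..<Suc (card (dom (filling_of P)))])"

text \<open>The state consists of the current filling \<open>F\<close> and the filling \<open>V\<close> of the boxes vacated so far.\<close>

definition jdt_step ::
    "partn list \<Rightarrow> filling \<times> filling \<Rightarrow> int \<times> nat \<Rightarrow> filling \<times> filling" where
  "jdt_step P = (\<lambda>(F, V) b. case slide F b of (F', c) \<Rightarrow> (F', V(c := filling_of P b)))"

definition jdt_fillings :: "partn list \<Rightarrow> partn list \<Rightarrow> filling \<times> filling" where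
  "jdt_fillings P Q = foldl (jdt_step P) (filling_of Q, Map.empty) (boxes_decreasing P)"

text \<open>\<open>jeu_de_taquin k k' P Q T U\<close> states \<open>\<J>(P, Q) = (T, U)\<close> for \<open>Q\<close> extending \<open>P\<close>.\<close>

definition jeu_de_taquin ::
    "nat \<Rightarrow> nat \<Rightarrow> partn list \<Rightarrow> partn list \<Rightarrow> partn list \<Rightarrow> partn list \<Rightarrow> bool" where
  "jeu_de_taquin k k' P Q T U \<longleftrightarrow>
     (\<exists>\<epsilon>. tableau k \<epsilon> (last Q) T) \<and>
     (\<exists>\<epsilon>. tableau k' (hd P) \<epsilon> U) \<and>
     jdt_fillings P Q = (filling_of U, filling_of T)"

end

theory Submission
  imports Defs
begin

text \<open>
  Write \<open>\<gamma> \<subseteq> \<delta> \<subseteq> \<beta>\<close> for two consecutive horizontal strips. Solving the local rule \<open>\<R>\<close> for its upper left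
  corner and removing the prepended parts \<open>l\<close> turns it into the Bender--Knuth involution, which
  replaces \<open>\<delta>\<close> by the shape that exchanges the numbers of free boxes of both strips in each row.
  Hence the growth diagram of \<open>\<R>(P, Q\<^sup>C)\<close> is, up to prepended parts, the array of shapes obtained by
  pushing the chain \<open>Q\<close> down along the strips of \<open>P\<close>, one strip at a time.

  On the other side, a slide into a single box crosses the entries \<open>1, 2, \<dots>\<close> of \<open>Q\<close> one after the other.
  While crossing the entries \<open>s\<close> the hole moves one step down if an \<open>s\<close> is below it, and otherwise to the
  right end of the \<open>s\<close>'s in its row; this is the Bender--Knuth involution for a one-box strip.
  Removing the rightmost box of \<open>\<delta>/\<gamma>\<close> commutes with the involution and removes the rightmost box of
  the resulting outer strip, so the slides into the boxes of a strip from right to left compose to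
  the involution for the whole strip.
\<close>

subsection \<open>Switching two horizontal strips\<close>

text \<open>At the first row the part of \<open>\<gamma>\<close> above is read as infinite, which makes \<open>bk\<close> independent of \<open>l\<close>.\<close>

definition bk :: "partn \<Rightarrow> partn \<Rightarrow> partn \<Rightarrow> partn" where
  "bk \<gamma> \<delta> \<beta> = Partn (start \<gamma>)
     (\<lambda>i. if i < start \<gamma> then 0
          else max (part \<beta> (i + 1)) (part \<gamma> i)
             + (if i = start \<gamma> then part \<beta> i else min (part \<beta> i) (part \<gamma> (i - 1)))
             - part \<delta> i)"

section \<open>Partitions and the interlacing of their rows\<close>

lemma is_partition_below: "is_partition \<gamma> \<Longrightarrow> i < start \<gamma> \<Longrightarrow> part \<gamma> i = 0"
  by (simp add: is_partition_def)

lemma is_partition_antimono: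
  assumes "is_partition \<gamma>" "start \<gamma> \<le> i" "i \<le> j"
  shows "part \<gamma> j \<le> part \<gamma> i"
  using assms(3)
proof (induction j rule: int_ge_induct)
  case (step j)
  then have "part \<gamma> (j + 1) \<le> part \<gamma> j"
    using assms(1,2) by (simp add: is_partition_def)
  then show ?case using step by simp
qed simp

lemma horizontal_stripD:
  assumes "horizontal_strip \<alpha> \<beta>"
  shows "start \<alpha> = start \<beta>"
    and "start \<beta> \<le> i \<Longrightarrow> part \<alpha> i \<le> part \<beta> i"
    and "start \<beta> \<le> i \<Longrightarrow> part \<beta> (i + 1) \<le> part \<alpha> i"
    and "start \<beta> < i \<Longrightarrow> part \<beta> i \<le> part \<alpha> (i - 1)"
proof -
  show "part \<beta> i \<le> part \<alpha> (i - 1)" if "start \<beta> < i"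
    using assms that unfolding horizontal_strip_def by (metis diff_add_cancel zle_diff1_eq)
qed (use assms in \<open>auto simp: horizontal_strip_def\<close>)

lemma horizontal_strip_le:
  assumes "horizontal_strip \<alpha> \<beta>" "is_partition \<alpha>"
  shows "part \<alpha> i \<le> part \<beta> i"
  using assms by (cases "i < start \<beta>") (auto simp: horizontal_strip_def is_partition_below)

text \<open>Interlacing gives the decrease: a part of \<alpha> is at most the part of \<beta> in its
  row, which is at most the part of \<alpha> in the row above. Rows before the first are outside the
  reach of \<open>horizontal_strip\<close>, hence the separate hypothesis on them.\<close>

lemma is_partition_between:
  assumes "horizontal_strip \<alpha> \<beta>" "is_partition \<beta>" "\<And>i. i < start \<beta> \<Longrightarrow> part \<alpha> i = 0"
  shows "is_partition \<alpha>"
proof -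
  note h = horizontal_stripD[OF assms(1)]
  have "part \<alpha> i \<le> part \<beta> i" for i
    using h(2) assms(3) by (cases "i < start \<beta>") auto
  then have "{i. part \<alpha> i \<noteq> 0} \<subseteq> {i. part \<beta> i \<noteq> 0}"
    by (auto intro: less_le_trans)
  moreover have "part \<alpha> (i + 1) \<le> part \<alpha> i" if "start \<beta> \<le> i" for i
    using h(2)[of "i + 1"] h(3)[OF that] that by simp
  ultimately show ?thesis
    using assms(2,3) h(1) finite_subset unfolding is_partition_def by auto
qed

lemma bk_simps:
  "start (bk \<gamma> \<delta> \<beta>) = start \<gamma>"
  "part (bk \<gamma> \<delta> \<beta>) i = (if i < start \<gamma> then 0
          else max (part \<beta> (i + 1)) (part \<gamma> i)
             + (if i = start \<gamma> then part \<beta> i else min (part \<beta> i) (part \<gamma> (i - 1)))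
             - part \<delta> i)"
  by (simp_all add: bk_def)

text \<open>\<open>part \<delta> i\<close> is at most the last summand, so the subtraction in
  \<open>bk\<close> does not truncate. In this additive form linear arithmetic applies.\<close>

lemma bk_add:
  assumes "horizontal_strip \<gamma> \<delta>" "horizontal_strip \<delta> \<beta>" "start \<gamma> \<le> i"
  shows "part (bk \<gamma> \<delta> \<beta>) i + part \<delta> i = max (part \<beta> (i + 1)) (part \<gamma> i)
             + (if i = start \<gamma> then part \<beta> i else min (part \<beta> i) (part \<gamma> (i - 1)))"
  using horizontal_stripD(1)[OF assms(1)] horizontal_stripD(2-4)[OF assms(1), of i]
    horizontal_stripD(1)[OF assms(2)] horizontal_stripD(2-4)[OF assms(2), of i] assms(3)
  by (auto simp: bk_simps)

text \<open>Interlacing with \<gamma> and \<beta> confines row i of \<delta> to the interval from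
  \<open>max (part \<beta> (i + 1)) (part \<gamma> i)\<close> to
  \<open>min (part \<beta> i) (part \<gamma> (i - 1))\<close>, or to \<open>part \<beta> i\<close>
  in the first row. \<open>bk\<close> reflects the part in this interval, so the new shape
  interlaces in the same way.\<close>

lemma bk_strips:
  assumes "horizontal_strip \<gamma> \<delta>" "horizontal_strip \<delta> \<beta>" "is_partition \<beta>"
  shows "horizontal_strip \<gamma> (bk \<gamma> \<delta> \<beta>)" "horizontal_strip (bk \<gamma> \<delta> \<beta>) \<beta>"
    "is_partition (bk \<gamma> \<delta> \<beta>)"
proof -
  note h1 = horizontal_stripD[OF assms(1)] and h2 = horizontal_stripD[OF assms(2)]
  have s: "start \<gamma> = start \<beta>" "start \<delta> = start \<beta>" using h1(1) h2(1) by simp_all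
  have a: "part \<gamma> i \<le> part (bk \<gamma> \<delta> \<beta>) i \<and> part (bk \<gamma> \<delta> \<beta>) i \<le> part \<beta> i
      \<and> part \<beta> (i + 1) \<le> part (bk \<gamma> \<delta> \<beta>) i" if "start \<beta> \<le> i" for i
    using bk_add[OF assms(1,2), of i] h1(2-4)[of i] h2(2-4)[of i] that s by (auto split: if_splits)
  have b: "part (bk \<gamma> \<delta> \<beta>) (i + 1) \<le> part \<gamma> i" if "start \<beta> \<le> i" for i
    using bk_add[OF assms(1,2), of "i + 1"] h1(2-4)[of "i + 1"] h2(2-4)[of "i + 1"] that s
    by (auto split: if_splits)
  show "horizontal_strip \<gamma> (bk \<gamma> \<delta> \<beta>)"
    using a b s by (simp add: horizontal_strip_def bk_simps(1))
  show st: "horizontal_strip (bk \<gamma> \<delta> \<beta>) \<beta>"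
    using a s by (simp add: horizontal_strip_def bk_simps(1))
  show "is_partition (bk \<gamma> \<delta> \<beta>)"
    by (rule is_partition_between[OF st assms(3)]) (simp add: bk_simps s)
qed

lemma partn_eqI: "start \<alpha> = start \<beta> \<Longrightarrow> (\<And>i. part \<alpha> i = part \<beta> i) \<Longrightarrow> \<alpha> = \<beta>"
  by (cases \<alpha>; cases \<beta>) auto

text \<open>If the inner strip is empty, every part sits at the lower end of its interval and is
  reflected to the upper end, which is the part of \<beta>.\<close>

lemma bk_same:
  assumes "horizontal_strip \<delta> \<beta>" "is_partition \<beta>"
  shows "bk \<delta> \<delta> \<beta> = \<beta>"
proof (rule partn_eqI)
  note h = horizontal_stripD[OF assms(1)]
  show "start (bk \<delta> \<delta> \<beta>) = start \<beta>" by (simp add: bk_simps h)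
  show "part (bk \<delta> \<delta> \<beta>) i = part \<beta> i" for i
    using h(2-4)[of i] assms(2) by (auto simp: bk_simps h(1) is_partition_below)
qed

section \<open>Removing the rightmost box of the inner strip\<close>

definition remove_box :: "int \<Rightarrow> partn \<Rightarrow> partn" where
  "remove_box i \<delta> = Partn (start \<delta>) ((part \<delta>)(i := part \<delta> i - 1))"

lemma remove_box_simps:
  "start (remove_box i \<delta>) = start \<delta>"
  "part (remove_box i \<delta>) j = (if j = i then part \<delta> i - 1 else part \<delta> j)"
  by (simp_all add: remove_box_def)

text \<open>The box ending row \<open>i\<close> of \<open>\<delta>\<close> is the rightmost box of the horizontal strip \<open>\<delta>/\<gamma>\<close>.\<close>

definition top_row :: "int \<Rightarrow> partn \<Rightarrow> partn \<Rightarrow> bool" where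
  "top_row i \<gamma> \<delta> \<longleftrightarrow> horizontal_strip \<gamma> \<delta> \<and> is_partition \<gamma> \<and> is_partition \<delta> \<and>
     part \<gamma> i < part \<delta> i \<and> (\<forall>j<i. part \<gamma> j = part \<delta> j)"

lemma top_row_start: "top_row i \<gamma> \<delta> \<Longrightarrow> start \<delta> \<le> i"
  unfolding top_row_def using is_partition_below[of \<delta> i] by force

lemma top_row_remove_box:
  assumes "top_row i \<gamma> \<delta>"
  shows "horizontal_strip \<gamma> (remove_box i \<delta>)" "top_row i (remove_box i \<delta>) \<delta>"
proof -
  have g: "horizontal_strip \<gamma> \<delta>" "is_partition \<gamma>" "is_partition \<delta>" "part \<gamma> i < part \<delta> i"
    using assms by (auto simp: top_row_def)
  note h = horizontal_stripD[OF g(1)]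
  have "part (remove_box i \<delta>) j \<ge> part \<gamma> j \<and> part (remove_box i \<delta>) (j+1) \<le> part \<gamma> j"
    if "start \<delta> \<le> j" for j
    using h(2,3)[OF that] g(4) by (auto simp: remove_box_simps)
  then show "horizontal_strip \<gamma> (remove_box i \<delta>)"
    by (simp add: horizontal_strip_def remove_box_simps h)
  have "part (remove_box i \<delta>) j \<le> part \<delta> j \<and> part \<delta> (j+1) \<le> part (remove_box i \<delta>) j"
    if "start \<delta> \<le> j" for j
    using h(2,3)[OF that] g(4) by (auto simp: remove_box_simps)
  then have st: "horizontal_strip (remove_box i \<delta>) \<delta>"
    by (simp add: horizontal_strip_def remove_box_simps h)
  moreover have "is_partition (remove_box i \<delta>)"
    using is_partition_between[OF st g(3)] g(3) by (simp add: remove_box_simps is_partition_below)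
  ultimately show "top_row i (remove_box i \<delta>) \<delta>"
    using g by (auto simp: top_row_def remove_box_simps)
qed

text \<open>The row i' is where a hole at the end of row i of \<delta> goes: one row down if the
  strip \<beta>/\<delta> has a box below it, otherwise to the end of its row. Above row i the shapes
  \<gamma> and \<delta> agree, so nothing changes there. In row i, the loss of one box of \<delta>
  is balanced by one end of the reflection interval: the upper end if i' = i, the lower end if i' =
  i + 1.\<close>

lemma bk_remove_box:
  assumes t: "top_row i \<gamma> \<delta>" and b: "horizontal_strip \<delta> \<beta>" "is_partition \<beta>"
  defines "i' \<equiv> if part \<beta> (i + 1) < part \<delta> i then i else i + 1"
  shows "top_row i' (bk \<gamma> \<delta> \<beta>) \<beta>"
    and "bk (remove_box i \<delta>) \<delta> \<beta> = remove_box i' \<beta>"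
    and "bk \<gamma> (remove_box i \<delta>) (remove_box i' \<beta>) = bk \<gamma> \<delta> \<beta>"
proof -
  have g: "horizontal_strip \<gamma> \<delta>" "is_partition \<gamma>" "is_partition \<delta>" "part \<gamma> i < part \<delta> i"
      "\<And>j. j < i \<Longrightarrow> part \<gamma> j = part \<delta> j"
    using t by (auto simp: top_row_def)
  note h1 = horizontal_stripD[OF g(1)] and h2 = horizontal_stripD[OF b(1)]
  have s: "start \<gamma> = start \<beta>" "start \<delta> = start \<beta>" using h1(1) h2(1) by simp_all
  have i: "start \<beta> \<le> i" using top_row_start[OF t] s by simp
  note bs = bk_strips[OF g(1) b]
  have p0: "part \<beta> j = 0" if "j < start \<beta>" for j using that b is_partition_below by auto
  show 2: "bk (remove_box i \<delta>) \<delta> \<beta> = remove_box i' \<beta>"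
  proof (rule partn_eqI)
    show "part (bk (remove_box i \<delta>) \<delta> \<beta>) j = part (remove_box i' \<beta>) j" for j
    proof (cases "j < start \<beta>")
      case True
      then show ?thesis using p0 i by (auto simp: bk_simps remove_box_simps i'_def s)
    next
      case False
      then have j: "start \<beta> \<le> j" by simp
      consider "j < i" | "j = i" | "j = i + 1" | "j > i + 1" by linarith
      then show ?thesis
        using h1(2-4)[of j] h2(2-4)[of j] h1(2-4)[of i] h2(2-4)[of i] g(4) g(5)[of j] i j s p0[of j]
          h1(2-4)[of "j+1"]
        by cases (auto simp: bk_simps remove_box_simps i'_def)
    qed
  qed (simp add: bk_simps remove_box_simps s)
  show "bk \<gamma> (remove_box i \<delta>) (remove_box i' \<beta>) = bk \<gamma> \<delta> \<beta>"
  proof (rule partn_eqI)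
    show "part (bk \<gamma> (remove_box i \<delta>) (remove_box i' \<beta>)) j = part (bk \<gamma> \<delta> \<beta>) j" for j
    proof (cases "j < start \<beta>")
      case True
      then show ?thesis by (auto simp: bk_simps s)
    next
      case False
      then have j: "start \<beta> \<le> j" by simp
      consider "j < i - 1" | "j = i - 1" | "j = i" | "j = i + 1" | "j > i + 1" by linarith
      then show ?thesis
        using h1(2-4)[of j] h2(2-4)[of j] h1(2-4)[of i] h2(2-4)[of i] g(4) g(5)[of j] g(5)[of "i-1"]
           i j s p0[of j] h1(2-4)[of "j+1"]
        by cases (auto simp: bk_simps remove_box_simps i'_def)
    qed
  qed (simp add: bk_simps)
  have "part (bk \<gamma> \<delta> \<beta>) j = part \<beta> j" if "j < i'" for j
  proof (cases "j < start \<beta>")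
    case True
    then show ?thesis using p0 by (simp add: bk_simps s)
  next
    case False
    have "j < i \<or> j = i \<and> \<not> part \<beta> (i + 1) < part \<delta> i"
      using that by (auto simp: i'_def split: if_splits)
    then show ?thesis
      using False h1(2-4)[of j] h2(2-4)[of j] g(4) g(5)[of j] g(5)[of "j-1"] i s
      by (elim disjE) (auto simp: bk_simps)
  qed
  moreover have "part (bk \<gamma> \<delta> \<beta>) i' < part \<beta> i'"
  proof (cases "part \<beta> (i + 1) < part \<delta> i")
    case True
    then show ?thesis
      using h1(2-4)[of i] h2(2-4)[of i] g(4) g(5)[of "i-1"] i s by (auto simp: bk_simps i'_def)
  next
    case False
    then show ?thesis
      using h1(2-4)[of i] h2(2-4)[of i] h1(2-4)[of "i+1"] h2(2-4)[of "i+1"] g(4) i s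
      by (auto simp: bk_simps i'_def)
  qed
  ultimately show "top_row i' (bk \<gamma> \<delta> \<beta>) \<beta>"
    using bs b by (auto simp: top_row_def)
qed

subsection \<open>Pushing a chain of shapes, and a single slide\<close>

text \<open>The inner chain is computed upwards from \<gamma>, each shape from its three neighbours
  in a square. Chains are functions on the naturals of which only the values up to a given length
  matter, so columns of an array can be used directly.\<close>

primrec push :: "partn \<Rightarrow> (nat \<Rightarrow> partn) \<Rightarrow> nat \<Rightarrow> partn" where
  "push \<gamma> C 0 = \<gamma>"
| "push \<gamma> C (Suc s) = bk (push \<gamma> C s) (C s) (C (Suc s))"

definition chain :: "nat \<Rightarrow> (nat \<Rightarrow> partn) \<Rightarrow> bool" where
  "chain k C \<longleftrightarrow> (\<forall>s\<le>k. is_partition (C s)) \<and> (\<forall>s<k. horizontal_strip (C s) (C (Suc s)))"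

definition shapes :: "nat \<Rightarrow> (nat \<Rightarrow> partn) \<Rightarrow> partn list" where
  "shapes k C = map C [0..<Suc k]"

lemma length_shapes: "length (shapes k C) = Suc k"
  by (simp add: shapes_def)

lemma nth_shapes: "s \<le> k \<Longrightarrow> shapes k C ! s = C s"
  using nth_map[of s "[0..<Suc k]" C] by (simp add: shapes_def del: upt_Suc)

lemma chain_mono:
  assumes "chain k C" "s \<le> t" "t \<le> k"
  shows "part (C s) i \<le> part (C t) i"
  using assms(2,3)
proof (induction t rule: dec_induct)
  case (step t)
  then have "part (C t) i \<le> part (C (Suc t)) i"
    using assms(1) by (intro horizontal_strip_le) (auto simp: chain_def)
  then show ?case using step by simp
qed simp

lemma tableau_chain: "tableau k \<alpha> \<beta> S \<Longrightarrow> chain k ((!) S)"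
  by (auto simp: tableau_def chain_def)

lemma chain_tableau:
  assumes "chain k C"
  shows "tableau k (C 0) (C k) (shapes k C)"
proof -
  have "shapes k C \<noteq> []" using length_shapes[of k C] by auto
  then show ?thesis
    using assms
    by (simp add: tableau_def chain_def length_shapes nth_shapes hd_conv_nth last_conv_nth
      all_set_conv_all_nth)
qed

lemma tableau_shapes: "tableau k \<alpha> \<beta> S \<Longrightarrow> S = shapes k ((!) S)"
  using map_nth[of S] by (simp add: tableau_def shapes_def del: upt_Suc)

lemma tableau_ends:
  assumes "tableau k \<alpha> \<beta> S"
  shows "S ! 0 = \<alpha>" "S ! k = \<beta>"
proof -
  have "length S = Suc k" "hd S = \<alpha>" "last S = \<beta>" using assms by (simp_all add: tableau_def)
  moreover from this have "S \<noteq> []" by auto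
  ultimately show "S ! 0 = \<alpha>" "S ! k = \<beta>" by (simp_all add: hd_conv_nth last_conv_nth)
qed

lemma push_strip:
  assumes "chain k C" "horizontal_strip \<gamma> (C 0)" "is_partition \<gamma>" "s \<le> k"
  shows "horizontal_strip (push \<gamma> C s) (C s) \<and> is_partition (push \<gamma> C s)"
  using assms(4)
proof (induction s)
  case (Suc s)
  then show ?case
    using assms(1) bk_strips[of "push \<gamma> C s" "C s" "C (Suc s)"] by (auto simp: chain_def)
qed (use assms in auto)

lemma chain_push:
  assumes "chain k C" "horizontal_strip \<gamma> (C 0)" "is_partition \<gamma>"
  shows "chain k (push \<gamma> C)"
  using push_strip[OF assms] assms(1) bk_strips(1)
  unfolding chain_def by auto

lemma push_same:
  assumes "chain k C" "s \<le> k"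
  shows "push (C 0) C s = C s"
  using assms(2) by (induction s) (use assms(1) in \<open>auto simp: chain_def intro!: bk_same\<close>)

text \<open>The strips of an increasing chain are disjoint: a box added at step j lies inside all
  later shapes. Hence the entry chosen by \<open>THE\<close> is unique.\<close>

lemma filling_of_shapes:
  assumes "chain k C"
  shows "filling_of (shapes k C) b = Some i \<longleftrightarrow>
    1 \<le> i \<and> i \<le> k \<and> b \<in> skew_boxes (C (i - 1)) (C i)"
proof -
  have h: "holds_entry (shapes k C) b i \<longleftrightarrow>
      1 \<le> i \<and> i \<le> k \<and> b \<in> skew_boxes (C (i - 1)) (C i)" for i
    by (auto simp: holds_entry_def length_shapes nth_shapes)
  have u: "i \<le> j" if "holds_entry (shapes k C) b i" "holds_entry (shapes k C) b j" for i j
  proof (rule ccontr)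
    assume "\<not> i \<le> j"
    then have "part (C j) r \<le> part (C (i - 1)) r" for r
      using that unfolding h by (intro chain_mono[OF assms]) auto
    moreover obtain r x where "b = (r, x)" by (cases b)
    ultimately show False
      using that unfolding h by (auto simp: skew_boxes_def) (metis le_less_trans leD)
  qed
  have "filling_of (shapes k C) b = Some i \<longleftrightarrow> holds_entry (shapes k C) b i"
  proof
    assume "holds_entry (shapes k C) b i"
    moreover from this have "(THE i. holds_entry (shapes k C) b i) = i"
      using u by (intro the_equality) (auto intro: antisym)
    ultimately show "filling_of (shapes k C) b = Some i"
      unfolding filling_of_def by auto
  next
    assume a: "filling_of (shapes k C) b = Some i"
    then obtain j where j: "holds_entry (shapes k C) b j"
      by (auto simp: filling_of_def split: if_splits)
    moreover from this have "(THE i. holds_entry (shapes k C) b i) = j"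
      using u by (intro the_equality) (auto intro: antisym)
    ultimately have "filling_of (shapes k C) b = Some j"
      unfolding filling_of_def by auto
    then show "holds_entry (shapes k C) b i" using a j by simp
  qed
  then show ?thesis using h by simp
qed

lemma option_ext: "(\<And>v. x = Some v \<longleftrightarrow> y = Some v) \<Longrightarrow> x = y"
  by (metis not_Some_eq)

section \<open>Moves of the hole in a single slide\<close>

definition sliding :: "filling \<times> (int \<times> nat) \<Rightarrow> bool" where
  "sliding = (\<lambda>(F, b). right_of b \<in> dom F \<or> below b \<in> dom F)"

lemma while_step: "c x \<Longrightarrow> f x = y \<Longrightarrow> while c f x = while c f y"
  by (subst while_unfold) simp

text \<open>The hole runs through a block of equal entries v up to column e, by induction on the
  distance left. Entries below the path must be strictly larger than v, since ties move the hole
  down.\<close>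

lemma slide_right:
  assumes "\<And>x. j < x \<Longrightarrow> x \<le> e \<Longrightarrow> F (i, x) = Some v"
    and "\<And>x w. j \<le> x \<Longrightarrow> x < e \<Longrightarrow> F (i + 1, x) = Some w \<Longrightarrow> v < w"
    and "F (i, j) = None" "j \<le> e"
  shows "while sliding slide_step (F, (i, j)) = while sliding slide_step
    (\<lambda>b. if fst b = i \<and> j \<le> snd b \<and> snd b < e then Some v else if b = (i, e) then None else F b, (i, e))"
  using assms
proof (induction "e - j" arbitrary: j F)
  case 0
  then have "(\<lambda>b. if fst b = i \<and> j \<le> snd b \<and> snd b < e then Some v
      else if b = (i, e) then None else F b) = F" by (auto simp: fun_eq_iff)
  then show ?case using 0 by simp
next
  case (Suc d)
  let ?F = "F((i, j) := Some v, (i, Suc j) := None)"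
  have je: "j < e" using Suc.hyps(2) by simp
  have r: "F (i, Suc j) = Some v" using Suc.prems(1) je by simp
  have "slide_step (F, (i, j)) = (?F, (i, Suc j))"
    using r Suc.prems(2)[of j] je
    by (auto simp: slide_step_def move_into_def below_def right_of_def)
  moreover have "sliding (F, (i, j))" using r by (auto simp: sliding_def right_of_def)
  ultimately have "while sliding slide_step (F, (i, j)) = while sliding slide_step (?F, (i, Suc j))"
    by (intro while_step)
  also have "\<dots> = while sliding slide_step
    (\<lambda>b. if fst b = i \<and> Suc j \<le> snd b \<and> snd b < e then Some v
       else if b = (i, e) then None else ?F b, (i, e))"
    by (rule Suc.hyps(1)) (use Suc.hyps(2) Suc.prems(1,3,4) Suc.prems(2)[OF Suc_leD] in auto)
  also have "(\<lambda>b. if fst b = i \<and> Suc j \<le> snd b \<and> snd b < e then Some v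
       else if b = (i, e) then None else ?F b) =
     (\<lambda>b. if fst b = i \<and> j \<le> snd b \<and> snd b < e then Some v
       else if b = (i, e) then None else F b)"
    using Suc.hyps(2) by (auto simp: fun_eq_iff)
  finally show ?case .
qed

lemma slide_down:
  assumes "F (i + 1, j) = Some v" "\<And>w. F (i, j + 1) = Some w \<Longrightarrow> v \<le> w"
  shows "while sliding slide_step (F, (i, j)) =
    while sliding slide_step (F((i, j) := Some v, (i + 1, j) := None), (i + 1, j))"
proof -
  have "slide_step (F, (i, j)) = (F((i, j) := Some v, (i + 1, j) := None), (i + 1, j))"
    using assms by (auto simp: slide_step_def move_into_def below_def right_of_def)
  moreover have "sliding (F, (i, j))" using assms by (auto simp: sliding_def below_def)
  ultimately show ?thesis by (intro while_step)
qed

text \<open>The filling at the moment when the hole has crossed exactly the entries \<open>1, \<dots>, s\<close>.\<close>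

definition partly_slid :: "nat \<Rightarrow> (nat \<Rightarrow> partn) \<Rightarrow> (nat \<Rightarrow> partn) \<Rightarrow> nat \<Rightarrow> filling \<Rightarrow> bool" where
  "partly_slid k N C s F \<longleftrightarrow> (\<forall>b v. F b = Some v \<longleftrightarrow> 1 \<le> v \<and> v \<le> k \<and>
     (if v \<le> s then b \<in> skew_boxes (N (v - 1)) (N v) else b \<in> skew_boxes (C (v - 1)) (C v)))"

text \<open>Two successive stages differ only in the entry \<open>Suc s\<close>, so only the old and
  the new strip of this entry have to be examined. The last hypothesis ensures that writing
  \<open>Suc s\<close> overwrites no other entry.\<close>

lemma partly_slidI:
  assumes "partly_slid k N C s F" "s < k"
    and "\<And>b. b \<in> skew_boxes (C s) (C (Suc s)) \<Longrightarrow> b \<notin> skew_boxes (N s) (N (Suc s)) \<Longrightarrow> F' b = None"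
    and "\<And>b. b \<in> skew_boxes (N s) (N (Suc s)) \<Longrightarrow> F' b = Some (Suc s)"
    and "\<And>b. b \<notin> skew_boxes (N s) (N (Suc s)) \<Longrightarrow> b \<notin> skew_boxes (C s) (C (Suc s)) \<Longrightarrow> F' b = F b"
    and "\<And>b v. b \<in> skew_boxes (N s) (N (Suc s)) \<Longrightarrow> F b = Some v \<Longrightarrow> v = Suc s"
  shows "partly_slid k N C (Suc s) F'"
proof -
  have F: "F b = Some v \<longleftrightarrow> 1 \<le> v \<and> v \<le> k \<and>
     (if v \<le> s then b \<in> skew_boxes (N (v - 1)) (N v) else b \<in> skew_boxes (C (v - 1)) (C v))" for b v
    using assms(1) unfolding partly_slid_def by (elim allE)
  have "F' b = Some v \<longleftrightarrow> 1 \<le> v \<and> v \<le> k \<and>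
     (if v \<le> Suc s then b \<in> skew_boxes (N (v - 1)) (N v) else b \<in> skew_boxes (C (v - 1)) (C v))"
    (is "_ \<longleftrightarrow> ?R") for b v
  proof -
    have old: "F b = Some (Suc s)" if "b \<in> skew_boxes (C s) (C (Suc s))"
      using F[of b "Suc s"] assms(2) that by simp
    show ?thesis
    proof (cases "v = Suc s")
      case True
      then have "?R \<longleftrightarrow> b \<in> skew_boxes (N s) (N (Suc s))" using assms(2) by simp
      moreover have "F b \<noteq> Some (Suc s)" if "b \<notin> skew_boxes (C s) (C (Suc s))"
        using F[of b "Suc s"] that by simp
      ultimately show ?thesis
        using True assms(3,4,5)[of b] by fastforce
    next
      case False
      then have "v \<le> Suc s \<longleftrightarrow> v \<le> s" by linarith
      then have "?R \<longleftrightarrow> F b = Some v" using F[of b v] by simp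
      moreover have "F' b = Some v \<longleftrightarrow> F b = Some v"
        using False old assms(3,4,5,6)[of b] by (metis option.distinct(1) option.inject)
      ultimately show ?thesis by simp
    qed
  qed
  then show ?thesis unfolding partly_slid_def by (intro allI)
qed

lemma partly_slidD:
  assumes "partly_slid k N C s F"
  shows "F b = Some v \<longleftrightarrow> 1 \<le> v \<and> v \<le> k \<and>
     (if v \<le> s then b \<in> skew_boxes (N (v - 1)) (N v) else b \<in> skew_boxes (C (v - 1)) (C v))"
  using assms unfolding partly_slid_def by (elim allE)

text \<open>Entries already crossed lie inside \<open>N s\<close>, the remaining ones outside
  \<open>C s\<close>. When \<open>N s\<close> is \<open>C s\<close> without one box, that box
  separates the two groups and is the empty position of the hole.\<close>

lemma partly_slid_bounds:
  assumes "partly_slid k N C s F" "chain k C" "chain k N" "s \<le> k" "F (r, x) = Some w"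
  shows "w \<le> s \<Longrightarrow> x \<le> part (N s) r" "s < w \<Longrightarrow> part (C s) r < x" 
    "s < w \<Longrightarrow> w \<le> t \<Longrightarrow> t \<le> k \<Longrightarrow> x \<le> part (C t) r"
proof -
  have w: "1 \<le> w" "w \<le> k" "if w \<le> s then (r, x) \<in> skew_boxes (N (w - 1)) (N w)
      else (r, x) \<in> skew_boxes (C (w - 1)) (C w)"
    using assms(1,5) unfolding partly_slid_def by blast+
  show "x \<le> part (N s) r" if "w \<le> s"
    using w that chain_mono[OF assms(3), of w s r] assms(4) by (auto simp: skew_boxes_def)
  show "part (C s) r < x" if "s < w"
  proof -
    have "part (C s) r \<le> part (C (w - 1)) r"
      using w(2) that by (intro chain_mono[OF assms(2)]) auto
    then show ?thesis using w that by (auto simp: skew_boxes_def)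
  qed
  show "x \<le> part (C t) r" if "s < w" "w \<le> t" "t \<le> k"
    using w that chain_mono[OF assms(2), of w t r] by (auto simp: skew_boxes_def)
qed

text \<open>The hole is the single box of \<open>C s\<close> outside \<open>N s\<close>. Whether an
  entry \<open>Suc s\<close> lies below it is the case distinction of \<open>bk_remove_box\<close>,
  so crossing this entry moves the hole to the box that \<open>bk\<close> removes from
  \<open>C (Suc s)\<close>.\<close>

lemma slide_strip:
  assumes C: "chain k C" and N: "chain k N" and s: "s < k" and F: "partly_slid k N C s F"
    and t: "top_row i (N s) (C s)" and Ns: "N s = remove_box i (C s)"
    and N1: "N (Suc s) = bk (N s) (C s) (C (Suc s))"
  shows "\<exists>i' F'. partly_slid k N C (Suc s) F' \<and> top_row i' (N (Suc s)) (C (Suc s)) \<and>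
    N (Suc s) = remove_box i' (C (Suc s)) \<and>
    while sliding slide_step (F, (i, part (C s) i)) =
    while sliding slide_step (F', (i', part (C (Suc s)) i'))"
proof -
  define i' where "i' = (if part (C (Suc s)) (i + 1) < part (C s) i then i else i + 1)"
  have st: "horizontal_strip (C s) (C (Suc s))" "is_partition (C (Suc s))"
    using C s by (auto simp: chain_def)
  have t': "top_row i' (N (Suc s)) (C (Suc s))" and Ns': "N (Suc s) = remove_box i' (C (Suc s))"
    using bk_remove_box(1,2)[OF t st] by (simp_all add: N1 Ns i'_def)
  have i: "start (C s) \<le> i" using top_row_start[OF t] .
  note h = horizontal_stripD[OF st(1)]
  have n: "horizontal_strip (N s) (C s)" using t by (simp add: top_row_def)
  have pos: "part (N s) i < part (C s) i" using t by (simp add: top_row_def)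
  have d1: "part (C s) (i + 1) < part (C s) i"
    using horizontal_stripD(3)[OF n, of i] i pos by simp
  have in_strip: "F (r, x) = Some (Suc s)" if "part (C s) r < x" "x \<le> part (C (Suc s)) r" for r x
  proof -
    show ?thesis using partly_slidD[OF F, of "(r, x)" "Suc s"] that s by (simp add: skew_boxes_def)
  qed
  note bd = partly_slid_bounds[OF F C N less_imp_le[OF s]]
  have hole: "F (i, part (C s) i) = None"
  proof (cases "F (i, part (C s) i)")
    case (Some w)
    then show ?thesis using bd(1,2)[OF Some] pos by (cases "w \<le> s") auto
  qed
  have old: "v = Suc s" if "b \<in> skew_boxes (N s) (N (Suc s))" "F b = Some v" for b v
  proof -
    obtain r x where b: "b = (r, x)" by (cases b)
    have x: "part (N s) r < x" "x \<le> part (C (Suc s)) r"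
      using that(1) by (auto simp: b skew_boxes_def Ns' remove_box_simps split: if_splits)
    show ?thesis
    proof (cases v "Suc s" rule: linorder_cases)
      case less
      then show ?thesis using bd(1)[OF that(2)[unfolded b]] x by auto
    next
      case greater
      then have "F b = Some v \<longleftrightarrow> 1 \<le> v \<and> v \<le> k \<and> b \<in> skew_boxes (C (v - 1)) (C v)"
        using partly_slidD[OF F, of b v] by simp
      then have "part (C (v - 1)) r < x" "v \<le> k"
        using that(2) by (auto simp: b skew_boxes_def)
      moreover from this greater have "part (C (Suc s)) r \<le> part (C (v - 1)) r"
        by (intro chain_mono[OF C]) auto
      ultimately show ?thesis using x(2) by simp
    qed auto
  qed
  show ?thesis
  proof (cases "part (C (Suc s)) (i + 1) < part (C s) i")
    case True
    then have i': "i' = i" by (simp add: i'_def)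
    let ?j = "part (C s) i" and ?e = "part (C (Suc s)) i"
    define F' where "F' = (\<lambda>b. if fst b = i \<and> ?j \<le> snd b \<and> snd b < ?e then Some (Suc s)
      else if b = (i, ?e) then None else F b)"
    \<comment> \<open>Column x is at least ?j, beyond the end of row i + 1 of \<open>C s\<close> and
      hence of \<open>N s\<close>, which excludes crossed entries. By the case assumption x is also
      beyond that row of \<open>C (Suc s)\<close>, which excludes \<open>Suc s\<close>.\<close>
    have "Suc s < w" if "?j \<le> x" "x < ?e" "F (i + 1, x) = Some w" for x w
    proof (rule ccontr)
      assume "\<not> Suc s < w"
      then consider "w \<le> s" | "w = Suc s" by linarith
      then show False
      proof cases
        case 1
        then show False
          using bd(1)[OF that(3) 1] that d1 horizontal_strip_le[OF n, of "i + 1"] t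
          by (auto simp: top_row_def)
      next
        case 2
        then show False using bd(3)[OF that(3), of "Suc s"] that True s by simp
      qed
    qed
    then have "while sliding slide_step (F, (i, ?j)) = while sliding slide_step (F', (i, ?e))"
      unfolding F'_def using h(2) i h(1) in_strip hole by (intro slide_right) auto
    moreover have "partly_slid k N C (Suc s) F'"
    proof (rule partly_slidI[OF F s _ _ _ old])
      fix b assume "b \<in> skew_boxes (C s) (C (Suc s))" "b \<notin> skew_boxes (N s) (N (Suc s))"
      then show "F' b = None"
        by (cases b) (auto simp: skew_boxes_def F'_def Ns Ns' i' remove_box_simps split: if_splits)
    next
      fix b assume "b \<in> skew_boxes (N s) (N (Suc s))"
      then show "F' b = Some (Suc s)"
        using in_strip
        by (cases b) (auto simp: skew_boxes_def F'_def Ns Ns' i' remove_box_simps split: if_splits)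
    next
      fix b assume "b \<notin> skew_boxes (N s) (N (Suc s))" "b \<notin> skew_boxes (C s) (C (Suc s))"
      then show "F' b = F b"
        using hole h(2)[of i] h(1) i pos
        by (cases b) (auto simp: skew_boxes_def F'_def Ns Ns' i' remove_box_simps split: if_splits)
    qed
    ultimately show ?thesis using t' Ns' i' by auto
  next
    case False
    then have i': "i' = i + 1" by (simp add: i'_def)
    \<comment> \<open>The strip condition turns the negated inequality into equality: the box below
      the hole is the last one in its row of \<open>C (Suc s)\<close>. By \<open>d1\<close> it holds
      \<open>Suc s\<close>.\<close>
    have eq: "part (C (Suc s)) (i + 1) = part (C s) i"
      using False h(1) h(3)[of i] i by simp
    let ?j = "part (C s) i"
    define F' where "F' = F((i, ?j) := Some (Suc s), (i + 1, ?j) := None)"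
    \<comment> \<open>The right neighbour lies outside \<open>N s\<close>, so it has not been
      crossed. A tie with the entry below is resolved downwards.\<close>
    have "Suc s \<le> w" if "F (i, ?j + 1) = Some w" for w
      using bd(1)[OF that] pos by (cases "w \<le> s") auto
    then have "while sliding slide_step (F, (i, ?j)) = while sliding slide_step (F', (i + 1, ?j))"
      unfolding F'_def using in_strip d1 eq by (intro slide_down) auto
    moreover have "partly_slid k N C (Suc s) F'"
    proof (rule partly_slidI[OF F s _ _ _ old])
      fix b assume "b \<in> skew_boxes (C s) (C (Suc s))" "b \<notin> skew_boxes (N s) (N (Suc s))"
      then show "F' b = None" using eq
        by (cases b) (auto simp: skew_boxes_def F'_def Ns Ns' i' remove_box_simps split: if_splits)
    next
      fix b assume "b \<in> skew_boxes (N s) (N (Suc s))"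
      then show "F' b = Some (Suc s)"
        using in_strip eq d1
        by (cases b) (auto simp: skew_boxes_def F'_def Ns Ns' i' remove_box_simps split: if_splits)
    next
      fix b assume "b \<notin> skew_boxes (N s) (N (Suc s))" "b \<notin> skew_boxes (C s) (C (Suc s))"
      then show "F' b = F b"
        using hole h(2)[of i] h(1) i pos eq d1
        by (cases b) (auto simp: skew_boxes_def F'_def Ns Ns' i' remove_box_simps split: if_splits)
    qed
    ultimately show ?thesis
      using t' Ns' i' eq by (intro exI[of _ i'] exI[of _ F'] conjI) simp_all
  qed
qed

text \<open>The hypothesis on i says that the last box of row i of \<open>C 0\<close> is an inner
  corner for the filling. Crossing the entries 1 to k one after the other applies
  \<open>slide_strip\<close> k times, and the resulting filling belongs to the pushed chain.\<close>

lemma slide_push: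
  assumes C: "chain k C" and t: "top_row i (remove_box i (C 0)) (C 0)"
  defines "N \<equiv> push (remove_box i (C 0)) C"
  shows "\<exists>i'. N k = remove_box i' (C k) \<and> top_row i' (N k) (C k) \<and>
    slide (filling_of (shapes k C)) (i, part (C 0) i) =
      (filling_of (shapes k N), (i', part (C k) i'))"
proof -
  have n: "horizontal_strip (remove_box i (C 0)) (C 0)" "is_partition (remove_box i (C 0))"
    using t by (simp_all add: top_row_def)
  have N: "chain k N" unfolding N_def by (rule chain_push[OF C n])
  have "\<exists>i' F'. partly_slid k N C s F' \<and> top_row i' (N s) (C s) \<and> N s = remove_box i' (C s) \<and>
    while sliding slide_step (filling_of (shapes k C), (i, part (C 0) i)) =
    while sliding slide_step (F', (i', part (C s) i'))" if "s \<le> k" for s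
    using that
  proof (induction s)
    case 0
    have "partly_slid k N C 0 (filling_of (shapes k C))"
      by (auto simp: partly_slid_def filling_of_shapes[OF C])
    then show ?case using t by (auto simp: N_def)
  next
    case (Suc s)
    then obtain i1 F1 where "partly_slid k N C s F1" "top_row i1 (N s) (C s)"
      "N s = remove_box i1 (C s)" and
      1: "while sliding slide_step (filling_of (shapes k C), (i, part (C 0) i)) =
      while sliding slide_step (F1, (i1, part (C s) i1))" by auto
    from slide_strip[OF C N _ this(1-3)] Suc.prems show ?case
      unfolding 1 by (simp add: N_def)
  qed
  from this[of k] obtain i' F' where i': "partly_slid k N C k F'" "top_row i' (N k) (C k)"
      "N k = remove_box i' (C k)"
    and w: "while sliding slide_step (filling_of (shapes k C), (i, part (C 0) i)) =
    while sliding slide_step (F', (i', part (C k) i'))" by auto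
  have F': "F' b = Some v \<longleftrightarrow> filling_of (shapes k N) b = Some v" for b v
    using partly_slidD[OF i'(1), of b v] unfolding filling_of_shapes[OF N] by auto
  then have F'': "F' = filling_of (shapes k N)" by (intro ext option_ext)
  have st: "horizontal_strip (N k) (C k)" and pos: "part (N k) i' < part (C k) i'"
    using i'(2) by (simp_all add: top_row_def)
  have out: "x \<le> part (N k) r" if "F' (r, x) = Some v" for r x v
    using that chain_mono[OF N, of v k r] unfolding F' filling_of_shapes[OF N]
    by (auto simp: skew_boxes_def)
  \<comment> \<open>All entries now lie inside \<open>N k\<close>, while the right and lower
    neighbours of the hole lie outside, so the loop stops with the hole at the vacated
    corner.\<close>
  have "\<not> sliding (F', (i', part (C k) i'))"
    using out[of i' "part (C k) i' + 1"] out[of "i' + 1" "part (C k) i'"] pos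
      horizontal_stripD(3)[OF st top_row_start[OF i'(2)]] i'(3)
    by (auto simp: sliding_def right_of_def below_def remove_box_simps)
  then have "while sliding slide_step (F', (i', part (C k) i')) = (F', (i', part (C k) i'))"
    by (subst while_unfold) simp
  then have "slide (filling_of (shapes k C)) (i, part (C 0) i) = (F', (i', part (C k) i'))"
    using w by (simp add: slide_def sliding_def)
  then show ?thesis using i' F'' by auto
qed

subsection \<open>Slides into all boxes of a strip\<close>

text \<open>Iterates \<open>bk_remove_box\<close> along the chain: sliding into the rightmost box
  first and then pushing along the rest of the strip has the same outcome as pushing along the whole
  strip.\<close>

lemma push_remove_box:
  assumes C: "chain k C" and t: "top_row i \<gamma> (C 0)" and s: "s \<le> k"
  shows "push \<gamma> (push (remove_box i (C 0)) C) s = push \<gamma> C s \<and>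
    (\<exists>i'. top_row i' (push \<gamma> C s) (C s) \<and> push (remove_box i (C 0)) C s = remove_box i' (C s))"
  using s
proof (induction s)
  case 0
  then show ?case using t by auto
next
  case (Suc s)
  then obtain i' where 1: "push \<gamma> (push (remove_box i (C 0)) C) s = push \<gamma> C s"
    "top_row i' (push \<gamma> C s) (C s)" "push (remove_box i (C 0)) C s = remove_box i' (C s)"
    by auto
  have "horizontal_strip (C s) (C (Suc s))" "is_partition (C (Suc s))"
    using C Suc.prems by (auto simp: chain_def)
  from bk_remove_box[OF 1(2) this] 1 show ?case by auto
qed

lemma skew_boxes_remove_box:
  assumes "top_row i \<gamma> \<delta>"
  shows "skew_boxes \<gamma> \<delta> = insert (i, part \<delta> i) (skew_boxes \<gamma> (remove_box i \<delta>))"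
    and "(i, part \<delta> i) \<notin> skew_boxes \<gamma> (remove_box i \<delta>)"
  using assms by (auto simp: skew_boxes_def remove_box_simps top_row_def split: if_splits)

lemma shapes_cong: "(\<And>s. s \<le> k \<Longrightarrow> C s = D s) \<Longrightarrow> shapes k C = shapes k D"
  by (simp add: shapes_def)

lemma skew_boxes_eq_outer:
  assumes "skew_boxes \<alpha> \<beta> = skew_boxes \<alpha> \<beta>'" "start \<beta> = start \<beta>'"
    "\<And>r. part \<alpha> r \<le> part \<beta> r" "\<And>r. part \<alpha> r \<le> part \<beta>' r"
  shows "\<beta> = \<beta>'"
proof (rule partn_eqI[OF assms(2)])
  have *: "(r, x) \<in> skew_boxes \<alpha> \<beta> \<longleftrightarrow> (r, x) \<in> skew_boxes \<alpha> \<beta>'" for r x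
    using assms(1) by simp
  show "part \<beta> r = part \<beta>' r" for r
    using *[of r "part \<beta> r"] *[of r "part \<beta>' r"] assms(3,4)[of r]
    by (auto simp: skew_boxes_def)
qed

lemma skew_boxes_eq_inner:
  assumes "skew_boxes \<alpha> \<beta> = skew_boxes \<alpha>' \<beta>" "start \<alpha> = start \<alpha>'"
    "\<And>r. part \<alpha> r \<le> part \<beta> r" "\<And>r. part \<alpha>' r \<le> part \<beta> r"
  shows "\<alpha> = \<alpha>'"
proof (rule partn_eqI[OF assms(2)])
  have *: "(r, x) \<in> skew_boxes \<alpha> \<beta> \<longleftrightarrow> (r, x) \<in> skew_boxes \<alpha>' \<beta>" for r x
    using assms(1) by simp
  show "part \<alpha> r = part \<alpha>' r" for r
    using *[of r "part \<alpha> r"] *[of r "part \<alpha>' r"] assms(3,4)[of r]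
    by (auto simp: skew_boxes_def)
qed

lemma skew_boxes_same: "skew_boxes \<alpha> \<alpha> = {}"
  by (auto simp: skew_boxes_def)

text \<open>Induction on the list, which runs from right to left. Its head is the rightmost box of
  the strip, the slide into it replaces C by \<open>push (remove_box i (C 0)) C\<close>, and
  \<open>push_remove_box\<close> identifies the result for the remaining boxes.\<close>

lemma jdt_strip:
  assumes "chain k C" "horizontal_strip \<gamma> (C 0)" "is_partition \<gamma>"
    and "sorted_wrt (\<lambda>b b'. snd b' < snd b) L" "set L = skew_boxes \<gamma> (C 0)"
    and "\<And>b. b \<in> set L \<Longrightarrow> filling_of P b = Some c"
  shows "foldl (jdt_step P) (filling_of (shapes k C), V) L =
    (filling_of (shapes k (push \<gamma> C)),
     \<lambda>b. if b \<in> skew_boxes (push \<gamma> C k) (C k) then Some c else V b)"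
  using assms
proof (induction L arbitrary: C V)
  case Nil
  have "\<gamma> = C 0"
  proof (rule skew_boxes_eq_outer[of \<gamma>])
    show "skew_boxes \<gamma> \<gamma> = skew_boxes \<gamma> (C 0)" using Nil.prems(5) by (simp add: skew_boxes_same)
  qed (use horizontal_stripD(1) horizontal_strip_le Nil.prems(2,3) in auto)
  then have "push \<gamma> C s = C s" if "s \<le> k" for s
    using push_same[OF Nil.prems(1) that] by simp
  then show ?case by (simp add: skew_boxes_same cong: shapes_cong)
next
  case (Cons x L)
  note g = Cons.prems(2,3)
  obtain i j where x: "x = (i, j)" by (cases x)
  have c0: "is_partition (C 0)" using Cons.prems(1) by (simp add: chain_def)
  have mx: "snd b \<le> j" if "b \<in> skew_boxes \<gamma> (C 0)" for b
    using that Cons.prems(4) unfolding Cons.prems(5)[symmetric] x by auto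
  have xin: "part \<gamma> i < j" "j \<le> part (C 0) i"
    using Cons.prems(5) by (auto simp: x skew_boxes_def set_eq_iff)
  \<comment> \<open>The head has the largest column in the strip, so it ends its row.\<close>
  have j: "j = part (C 0) i"
    using mx[of "(i, part (C 0) i)"] xin by (auto simp: skew_boxes_def)
  have "start (C 0) \<le> i" using is_partition_below[OF c0, of i] xin by force
  \<comment> \<open>A strip box in a higher row would lie strictly right of column j: there
    \<open>part \<gamma> r\<close> is at least the part of \<open>C 0\<close> in the row below,
    which is at least j.\<close>
  have "part \<gamma> r = part (C 0) r" if "r < i" for r
  proof (rule ccontr)
    assume ne: "part \<gamma> r \<noteq> part (C 0) r"
    then have r: "start (C 0) \<le> r"
      using is_partition_below[OF c0, of r] is_partition_below[OF g(2), of r]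
        horizontal_stripD(1)[OF g(1)] by force
    have lt: "part \<gamma> r < part (C 0) r" using horizontal_stripD(2)[OF g(1) r] ne by simp
    then have "part (C 0) r \<le> j" using mx[of "(r, part (C 0) r)"] by (simp add: skew_boxes_def)
    moreover have "j \<le> part \<gamma> r"
      using j horizontal_stripD(3)[OF g(1) r] is_partition_antimono[OF c0, of "r + 1" i] that r by simp
    ultimately show False using lt by simp
  qed
  then have t: "top_row i \<gamma> (C 0)" using g c0 xin by (simp add: top_row_def)
  define D where "D = push (remove_box i (C 0)) C"
  note t' = top_row_remove_box[OF t]
  obtain i' where i': "D k = remove_box i' (C k)" and
    sl: "slide (filling_of (shapes k C)) (i, part (C 0) i) =
      (filling_of (shapes k D), (i', part (C k) i'))" and ti': "top_row i' (D k) (C k)"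
    using slide_push[OF Cons.prems(1) t'(2)] unfolding D_def by blast
  have D: "chain k D"
    unfolding D_def using t'(2) by (intro chain_push Cons.prems(1)) (auto simp: top_row_def)
  have D0: "D 0 = remove_box i (C 0)" by (simp add: D_def)
  have pp: "push \<gamma> D s = push \<gamma> C s" if "s \<le> k" for s
    using push_remove_box[OF Cons.prems(1) t that] by (simp add: D_def)
  obtain i'' where i'': "top_row i'' (push \<gamma> C k) (C k)" "D k = remove_box i'' (C k)"
    using push_remove_box[OF Cons.prems(1) t, of k] by (auto simp: D_def)
  \<comment> \<open>The slide and the push give the row of the removed box independently. Both
    describe \<open>D k\<close> as \<open>C k\<close> with one box removed, so the rows
    agree.\<close>
  have "i'' = i'"
  proof (rule ccontr)
    assume "i'' \<noteq> i'"
    then have "part (D k) i'' = part (C k) i''" unfolding i' by (simp add: remove_box_simps)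
    then show False using i''(1) unfolding i''(2) by (auto simp: remove_box_simps top_row_def)
  qed
  have S: "skew_boxes (push \<gamma> C k) (C k) = insert (i', part (C k) i') (skew_boxes (push \<gamma> D k) (D k))"
    using skew_boxes_remove_box(1)[OF i''(1)] pp[of k] i''(2) \<open>i'' = i'\<close> by simp
  have "set L = skew_boxes \<gamma> (D 0)"
  proof -
    have "x \<notin> set L" using Cons.prems(4) by auto
    then have "set L = skew_boxes \<gamma> (C 0) - {x}" using Cons.prems(5) by auto
    also have "\<dots> = skew_boxes \<gamma> (D 0)"
      using skew_boxes_remove_box[OF t] unfolding D0 x j by auto
    finally show ?thesis .
  qed
  note IH = Cons.IH[OF D _ g(2) _ this]
  have "foldl (jdt_step P) (filling_of (shapes k C), V) (x # L) =
    foldl (jdt_step P) (filling_of (shapes k D), V((i', part (C k) i') := Some c)) L"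
    using sl Cons.prems(6)[of x] by (simp add: jdt_step_def x j)
  also have "\<dots> = (filling_of (shapes k (push \<gamma> D)),
     \<lambda>b. if b \<in> skew_boxes (push \<gamma> D k) (D k) then Some c else (V((i', part (C k) i') := Some c)) b)"
    using t' Cons.prems(4,6) by (intro IH) (auto simp: D0)
  also have "\<dots> = (filling_of (shapes k (push \<gamma> C)),
     \<lambda>b. if b \<in> skew_boxes (push \<gamma> C k) (C k) then Some c else V b)"
    unfolding S using pp by (auto simp: fun_eq_iff cong: shapes_cong)
  finally show ?case .
qed

text \<open>A filling records boxes only; the shapes are recovered from it strip by strip once a
  border is fixed. Here the inner border is fixed, as for the tableau U of the jeu de
  taquin.\<close>

lemma chain_eq_from_inner:
  assumes C: "chain k C" and D: "chain k D"
    and eq: "filling_of (shapes k C) = filling_of (shapes k D)"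
    and "C 0 = D 0" "s \<le> k"
  shows "C s = D s"
  using assms(5)
proof (induction s)
  case (Suc s)
  then have h: "horizontal_strip (C s) (C (Suc s))" "horizontal_strip (C s) (D (Suc s))" "is_partition (C s)"
    using C D unfolding chain_def by (metis Suc_le_eq Suc_leD)+
  have "b \<in> skew_boxes (C s) (C (Suc s)) \<longleftrightarrow> b \<in> skew_boxes (C s) (D (Suc s))" for b
    using filling_of_shapes[OF C, of b "Suc s"] filling_of_shapes[OF D, of b "Suc s"] eq Suc by auto
  then show ?case
    using horizontal_stripD(1)[OF h(1)] horizontal_stripD(1)[OF h(2)] horizontal_strip_le h
    by (intro skew_boxes_eq_outer[of "C s"]) auto
qed (use assms in auto)

text \<open>The same reconstruction run inwards, as needed for T, whose outer border is
  given.\<close>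

lemma chain_eq_from_outer:
  assumes C: "chain k C" and D: "chain k D"
    and eq: "filling_of (shapes k C) = filling_of (shapes k D)"
    and "C k = D k" "s \<le> k"
  shows "C s = D s"
  using assms(5)
proof (induction s rule: inc_induct)
  case (step s)
  then have h: "horizontal_strip (C s) (C (Suc s))" "horizontal_strip (D s) (C (Suc s))"
    "is_partition (C s)" "is_partition (D s)"
    using C D unfolding chain_def by (metis less_imp_le)+
  have "b \<in> skew_boxes (C s) (C (Suc s)) \<longleftrightarrow> b \<in> skew_boxes (D s) (C (Suc s))" for b
    using filling_of_shapes[OF C, of b "Suc s"] filling_of_shapes[OF D, of b "Suc s"] eq step by auto
  then show ?case
    using horizontal_stripD(1)[OF h(1)] horizontal_stripD(1)[OF h(2)] horizontal_strip_le h
    by (intro skew_boxes_eq_inner[of _ "C (Suc s)"]) auto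
qed (use assms in auto)

section \<open>The order of slides given by standard renumbering\<close>

lemma finite_skew_boxes:
  assumes "is_partition \<beta>"
  shows "finite (skew_boxes \<alpha> \<beta>)"
proof (rule finite_subset)
  show "skew_boxes \<alpha> \<beta> \<subseteq> Sigma {i. part \<beta> i \<noteq> 0} (\<lambda>i. {..part \<beta> i})"
    by (auto simp: skew_boxes_def)
  show "finite (Sigma {i. part \<beta> i \<noteq> 0} (\<lambda>i. {..part \<beta> i}))"
    using assms by (auto simp: is_partition_def)
qed

text \<open>If one box were lower in the same column, its row of \<beta> would be no longer than the
  row of \<alpha> containing the other box's left neighbours, which ends before that column. Hence
  the column breaks all ties between equal entries.\<close>

lemma strip_columns_distinct:
  assumes h: "horizontal_strip \<alpha> \<beta>" "is_partition \<beta>"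
    and b: "b \<in> skew_boxes \<alpha> \<beta>" "b' \<in> skew_boxes \<alpha> \<beta>" "snd b = snd b'"
  shows "b = b'"
proof -
  have le: "fst b' \<le> fst b"
    if b: "b \<in> skew_boxes \<alpha> \<beta>" "b' \<in> skew_boxes \<alpha> \<beta>" "snd b = snd b'" for b b'
  proof (rule ccontr)
    assume n: "\<not> fst b' \<le> fst b"
    have s: "start \<beta> \<le> fst b"
      using b(1) is_partition_below[OF h(2), of "fst b"] by (force simp: skew_boxes_def)
    have "snd b \<le> part \<beta> (fst b')" "part \<alpha> (fst b) < snd b"
      using b by (auto simp: skew_boxes_def)
    then show False
      using horizontal_stripD(3)[OF h(1) s] is_partition_antimono[OF h(2), of "fst b + 1" "fst b'"] n s
      by simp
  qed
  show ?thesis using le[OF b] le[OF b(2,1)] b(3) by (auto simp: prod_eq_iff)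
qed

text \<open>The strict order in which \<open>standard_number\<close> counts positions, linear on the
  boxes of a tableau.\<close>

definition box_prec :: "partn list \<Rightarrow> int \<times> nat \<Rightarrow> int \<times> nat \<Rightarrow> bool" where
  "box_prec P b' b \<longleftrightarrow> the (filling_of P b') < the (filling_of P b) \<or>
     filling_of P b' = filling_of P b \<and> snd b' < snd b"

text \<open>\<open>standard_number\<close> is the rank in a finite linear order, hence a bijection
  onto an initial segment of the positive integers. Inverting it on the reversed segment lists the
  boxes in decreasing order.\<close>

lemma boxes_decreasing_sorted:
  assumes "tableau k \<alpha> \<beta> P"
  shows "set (boxes_decreasing P) = dom (filling_of P)"
    "sorted_wrt (\<lambda>b b'. box_prec P b' b) (boxes_decreasing P)"
proof -
  let ?D = "dom (filling_of P)" and ?n = "standard_number P"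
  have C: "chain k ((!) P)" using tableau_chain[OF assms] .
  have F: "filling_of P b = Some i \<longleftrightarrow> 1 \<le> i \<and> i \<le> k \<and> b \<in> skew_boxes (P ! (i - 1)) (P ! i)" for b i
    using filling_of_shapes[OF C] tableau_shapes[OF assms] by simp
  have fin: "finite ?D"
  proof (rule finite_subset)
    show "?D \<subseteq> (\<Union>i\<in>{1..k}. skew_boxes (P ! (i - 1)) (P ! i))" using F by force
    show "finite (\<Union>i\<in>{1..k}. skew_boxes (P ! (i - 1)) (P ! i))"
      using C by (auto simp: chain_def intro!: finite_skew_boxes)
  qed
  have inj: "b = b'" if eq: "b \<in> ?D" "filling_of P b = filling_of P b'" "snd b = snd b'" for b b'
  proof -
    obtain i where i: "filling_of P b = Some i" "filling_of P b' = Some i"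
      using eq(1,2) by fastforce
    then have "b \<in> skew_boxes (P ! (i - 1)) (P ! i)" "b' \<in> skew_boxes (P ! (i - 1)) (P ! i)"
      "Suc (i - 1) = i" "i \<le> k"
      using F by auto
    moreover from this have "horizontal_strip (P ! (i - 1)) (P ! i)" "is_partition (P ! i)"
      using C unfolding chain_def by (metis Suc_le_eq, blast)
    ultimately show ?thesis using strip_columns_distinct eq(3) by blast
  qed
  have lin: "box_prec P b b' \<or> b = b' \<or> box_prec P b' b" if "b \<in> ?D" "b' \<in> ?D" for b b'
    using inj[of b b'] that unfolding box_prec_def
    by (cases "snd b" "snd b'" rule: linorder_cases) (auto simp: not_less)
  \<comment> \<open>A larger box has strictly more predecessors, itself among them.\<close>
  have less: "?n b < ?n b'" if bb: "b \<in> ?D" "b' \<in> ?D" "box_prec P b b'" for b b'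
    unfolding standard_number_def
  proof (rule psubset_card_mono)
    show "{x \<in> ?D. the (filling_of P x) < the (filling_of P b) \<or> filling_of P x = filling_of P b \<and> snd x \<le> snd b}
      \<subset> {x \<in> ?D. the (filling_of P x) < the (filling_of P b') \<or> filling_of P x = filling_of P b' \<and> snd x \<le> snd b'}"
      (is "?A \<subset> ?B")
    proof
      show "?A \<subseteq> ?B" using that by (auto simp: box_prec_def)
      have "b' \<in> ?B" using that(2) by simp
      moreover have "b' \<notin> ?A"
      proof -
        consider "the (filling_of P b) < the (filling_of P b')"
          | "filling_of P b = filling_of P b'" "snd b < snd b'"
          using bb(3) unfolding box_prec_def by blast
        then show ?thesis by cases auto
      qed
      ultimately show "?A \<noteq> ?B" by blast
    qed
  qed (use fin in auto)
  have inj_n: "inj_on ?n ?D"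
  proof (rule inj_onI)
    fix b b' assume "b \<in> ?D" "b' \<in> ?D" "?n b = ?n b'"
    then show "b = b'" using lin[of b b'] less[of b b'] less[of b' b] by auto
  qed
  have "?n ` ?D \<subseteq> {1..card ?D}"
  proof
    fix m assume "m \<in> ?n ` ?D"
    then obtain b where b: "b \<in> ?D" "m = ?n b" by auto
    have "?n b \<le> card ?D" unfolding standard_number_def using fin by (intro card_mono) auto
    moreover have "?n b > 0"
      unfolding standard_number_def card_gt_0_iff
    proof
      show "finite {x \<in> ?D. the (filling_of P x) < the (filling_of P b) \<or>
          filling_of P x = filling_of P b \<and> snd x \<le> snd b}"
        using fin by simp
      have "b \<in> {x \<in> ?D. the (filling_of P x) < the (filling_of P b) \<or>
          filling_of P x = filling_of P b \<and> snd x \<le> snd b}"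
        using b(1) by simp
      then show "{x \<in> ?D. the (filling_of P x) < the (filling_of P b) \<or>
          filling_of P x = filling_of P b \<and> snd x \<le> snd b} \<noteq> {}"
        by (rule ex_in_conv[THEN iffD1, OF exI])
    qed
    ultimately show "m \<in> {1..card ?D}" using b by auto
  qed
  then have im: "?n ` ?D = {1..card ?D}"
    by (intro card_subset_eq) (auto simp: card_image[OF inj_n])
  let ?g = "inv_into ?D ?n"
  have g: "?g m \<in> ?D" "?n (?g m) = m" if "1 \<le> m" "m \<le> card ?D" for m
    using inv_into_into[of m ?n ?D] f_inv_into_f[of m ?n ?D] that unfolding im by auto
  have "set (boxes_decreasing P) = ?g ` {1..card ?D}"
    by (auto simp: boxes_decreasing_def simp del: upt_Suc)
  also have "\<dots> = ?D"
    unfolding im[symmetric] using inj_n by (auto simp: image_iff)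
  finally show "set (boxes_decreasing P) = ?D" .
  have "box_prec P (?g m) (?g m')" if "1 \<le> m" "m < m'" "m' \<le> card ?D" for m m'
  proof -
    have D: "?g m \<in> ?D" "?g m' \<in> ?D" and n: "?n (?g m) = m" "?n (?g m') = m'"
      using g[of m] g[of m'] that by simp_all
    have "\<not> ?n (?g m') < ?n (?g m)" using that(2) n by simp
    then have "\<not> box_prec P (?g m') (?g m)" using less[OF D(2,1)] by blast
    moreover have "?g m \<noteq> ?g m'" using that(2) n by (metis less_irrefl)
    ultimately show ?thesis using lin[OF D] by blast
  qed
  then have "sorted_wrt (\<lambda>m' m. box_prec P (?g m) (?g m')) (rev [1..<Suc (card ?D)])"
    unfolding sorted_wrt_rev
    by (intro sorted_wrt_mono_rel[OF _ sorted_wrt_upt]) (auto simp del: upt_Suc)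
  then show "sorted_wrt (\<lambda>b b'. box_prec P b' b) (boxes_decreasing P)"
    unfolding boxes_decreasing_def sorted_wrt_map .
qed

text \<open>In a list with decreasing entries, those equal to \<open>Suc c\<close> form a block
  after all larger ones. This isolates the slides into one strip of P.\<close>

lemma filter_sorted_split:
  fixes e :: "'a \<Rightarrow> nat"
  assumes "sorted_wrt (\<lambda>x y. e y \<le> e x) L"
  shows "filter (\<lambda>b. c < e b) L = filter (\<lambda>b. Suc c < e b) L @ filter (\<lambda>b. e b = Suc c) L"
  using assms
proof (induction L)
  case (Cons x L)
  show ?case
  proof (cases "Suc c < e x")
    case False
    then have "\<forall>y\<in>set L. \<not> Suc c < e y" using Cons.prems by auto
    then have "filter (\<lambda>b. Suc c < e b) L = []" by (simp add: filter_empty_conv)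
    then show ?thesis using Cons False by auto
  qed (use Cons in auto)
qed simp

subsection \<open>The jeu de taquin\<close>

text \<open>
  \<open>H c s\<close> is the shape in column \<open>c\<close>, counted from the left, and in row \<open>s\<close>, counted from the bottom, of
  the growth diagram without prepended parts.
\<close>

locale switching_grid =
  fixes k k' :: nat and P Q :: "partn list" and \<alpha> \<beta> \<delta> :: partn and H :: "nat \<Rightarrow> nat \<Rightarrow> partn"
  assumes P: "tableau k \<alpha> \<beta> P" and Q: "tableau k' \<beta> \<delta> Q"
    and H_last: "H k = (!) Q"
    and H_step: "c < k \<Longrightarrow> H c = push (P ! c) (H (Suc c))"
begin

lemma H_0: "c \<le> k \<Longrightarrow> H c 0 = P ! c"
  using H_step[of c] H_last tableau_ends[OF P] tableau_ends[OF Q] by (cases "c = k") auto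

lemma P_strip: "c < k \<Longrightarrow> horizontal_strip (P ! c) (P ! Suc c)" "c \<le> k \<Longrightarrow> is_partition (P ! c)"
  using tableau_chain[OF P] by (simp_all add: chain_def)

lemma chain_col: "c \<le> k \<Longrightarrow> chain k' (H c)"
proof (induction c rule: inc_induct)
  case base
  then show ?case using tableau_chain[OF Q] H_last by simp
next
  case (step c)
  then show ?case
    unfolding H_step[OF step.hyps(2)] by (intro chain_push) (use P_strip H_0 in auto)
qed

lemma strip_row:
  assumes "c < k" "s \<le> k'"
  shows "horizontal_strip (H c s) (H (Suc c) s)"
  unfolding H_step[OF assms(1)]
  using push_strip[of k' "H (Suc c)" "P ! c" s] assms chain_col[of "Suc c"] P_strip H_0 by auto

lemma chain_row: "s \<le> k' \<Longrightarrow> chain k (\<lambda>c. H c s)"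
  using chain_col strip_row by (simp add: chain_def)

lemma H_bk: "c < k \<Longrightarrow> H c (Suc s) = bk (H c s) (H (Suc c) s) (H (Suc c) (Suc s))"
  by (simp add: H_step)

lemma filling_P:
  "filling_of P b = Some i \<longleftrightarrow> 1 \<le> i \<and> i \<le> k \<and> b \<in> skew_boxes (P ! (i - 1)) (P ! i)"
  using filling_of_shapes[OF tableau_chain[OF P]] tableau_shapes[OF P] by simp

lemma entry_bounds:
  assumes "b \<in> set (boxes_decreasing P)"
  shows "0 < the (filling_of P b)" "the (filling_of P b) \<le> k"
proof -
  obtain i where "filling_of P b = Some i"
    using assms boxes_decreasing_sorted(1)[OF P] by auto
  moreover from this have "1 \<le> i" "i \<le> k" by (simp_all only: filling_P)
  ultimately show "0 < the (filling_of P b)" "the (filling_of P b) \<le> k" by simp_all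
qed

text \<open>Invariant of the jeu de taquin, proved downwards from c = k: after the slides into all
  boxes of P with entries above c, the filling is that of column c, and the vacated boxes form the
  part of row k' from column c on.\<close>

lemma jdt_partial:
  assumes "c \<le> k"
  shows "\<exists>V. foldl (jdt_step P) (filling_of Q, Map.empty)
       (filter (\<lambda>b. c < the (filling_of P b)) (boxes_decreasing P)) = (filling_of (shapes k' (H c)), V) \<and>
     (\<forall>b i. V b = Some i \<longleftrightarrow> c < i \<and> i \<le> k \<and> b \<in> skew_boxes (H (i - 1) k') (H i k'))"
  using assms
proof (induction c rule: inc_induct)
  case base
  have "filter (\<lambda>b. k < the (filling_of P b)) (boxes_decreasing P) = []"
    using entry_bounds(2) by (auto simp: filter_empty_conv not_less)
  then show ?case
    using tableau_shapes[OF Q] H_last by auto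
next
  case (step c)
  let ?L = "boxes_decreasing P" and ?e = "\<lambda>b. the (filling_of P b)"
  let ?M = "filter (\<lambda>b. ?e b = Suc c) ?L"
  note L = boxes_decreasing_sorted[OF P]
  have row: "filling_of (shapes k (\<lambda>c. H c k')) b = Some i \<longleftrightarrow>
      1 \<le> i \<and> i \<le> k \<and> b \<in> skew_boxes (H (i - 1) k') (H i k')" for b i
    using filling_of_shapes[OF chain_row] by simp
  have "sorted_wrt (\<lambda>x y. ?e y \<le> ?e x) ?L"
    by (rule sorted_wrt_mono_rel[OF _ L(2)]) (auto simp: box_prec_def)
  then have split: "filter (\<lambda>b. c < ?e b) ?L = filter (\<lambda>b. Suc c < ?e b) ?L @ ?M"
    by (rule filter_sorted_split)
  obtain V where V: "foldl (jdt_step P) (filling_of Q, Map.empty) (filter (\<lambda>b. Suc c < ?e b) ?L) =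
      (filling_of (shapes k' (H (Suc c))), V)"
    "\<And>b i. V b = Some i \<longleftrightarrow> Suc c < i \<and> i \<le> k \<and> b \<in> skew_boxes (H (i - 1) k') (H i k')"
    using step.IH by blast
  have setM: "b \<in> set ?M \<longleftrightarrow> filling_of P b = Some (Suc c)" for b
    by (auto simp: L(1))
  have "sorted_wrt (\<lambda>b b'. snd b' < snd b) ?M"
    by (rule sorted_wrt_mono_rel[OF _ sorted_wrt_filter[OF L(2)]])
      (use setM in \<open>auto simp: box_prec_def\<close>)
  moreover have "set ?M = skew_boxes (P ! c) (H (Suc c) 0)"
    using setM filling_P[of _ "Suc c"] step.hyps H_0[of "Suc c"] by auto
  ultimately have "foldl (jdt_step P) (filling_of (shapes k' (H (Suc c))), V) ?M =
    (filling_of (shapes k' (push (P ! c) (H (Suc c)))),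
     \<lambda>b. if b \<in> skew_boxes (push (P ! c) (H (Suc c)) k') (H (Suc c) k') then Some (Suc c) else V b)"
    using step.hyps setM chain_col[of "Suc c"] P_strip[of c] H_0[of "Suc c"]
    by (intro jdt_strip) auto
  then have f: "foldl (jdt_step P) (filling_of Q, Map.empty) (filter (\<lambda>b. c < ?e b) ?L) =
    (filling_of (shapes k' (H c)),
     \<lambda>b. if b \<in> skew_boxes (H c k') (H (Suc c) k') then Some (Suc c) else V b)"
    unfolding split H_step[OF step.hyps(2)] using V(1) by simp
  have "((if b \<in> skew_boxes (H c k') (H (Suc c) k') then Some (Suc c) else V b) = Some i) \<longleftrightarrow>
    c < i \<and> i \<le> k \<and> b \<in> skew_boxes (H (i - 1) k') (H i k')" for b i
  proof (cases "b \<in> skew_boxes (H c k') (H (Suc c) k')")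
    \<comment> \<open>Entries of row k' are unique, so a box in this strip admits only i =
      \<open>Suc c\<close>, and V is overridden consistently.\<close>
    case True
    then have "filling_of (shapes k (\<lambda>c. H c k')) b = Some (Suc c)" using row step.hyps by simp
    then show ?thesis using True row[of b i] step.hyps by auto
  next
    case False
    then show ?thesis using V(2)[of b i] by (cases "i = Suc c") auto
  qed
  then show ?case using f by blast
qed

lemma jdt_fillings_grid:
  "jdt_fillings P Q = (filling_of (shapes k' (H 0)), filling_of (shapes k (\<lambda>c. H c k')))"
proof -
  have "filter (\<lambda>b. 0 < the (filling_of P b)) (boxes_decreasing P) = boxes_decreasing P"
    using entry_bounds(1) by (simp add: filter_id_conv)
  then obtain V where V: "jdt_fillings P Q = (filling_of (shapes k' (H 0)), V)"
     "\<And>b i. V b = Some i \<longleftrightarrow> 0 < i \<and> i \<le> k \<and> b \<in> skew_boxes (H (i - 1) k') (H i k')"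
    using jdt_partial[of 0] unfolding jdt_fillings_def by auto
  have "V = filling_of (shapes k (\<lambda>c. H c k'))"
    by (intro ext option_ext) (auto simp: V(2) filling_of_shapes[OF chain_row[OF order_refl]])
  then show ?thesis using V(1) by simp
qed

lemma H_corners: "H 0 0 = \<alpha>" "H k k' = \<delta>"
  using H_0[of 0] tableau_ends[OF P] tableau_ends[OF Q] H_last by auto

text \<open>Gives existence and uniqueness of the result: the fillings together with the borders
  \<delta> of T and \<alpha> of U determine both chains.\<close>

lemma jeu_de_taquin_grid:
  "jeu_de_taquin k k' P Q T U \<longleftrightarrow> T = shapes k (\<lambda>c. H c k') \<and> U = shapes k' (H 0)"
proof
  have ends: "hd P = \<alpha>" "last Q = \<delta>" using P Q by (simp_all add: tableau_def)
  have row: "chain k (\<lambda>c. H c k')" and col: "chain k' (H 0)"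
    using chain_row chain_col by simp_all
  show "jeu_de_taquin k k' P Q T U" if "T = shapes k (\<lambda>c. H c k') \<and> U = shapes k' (H 0)"
    using that chain_tableau[OF row] chain_tableau[OF col] jdt_fillings_grid
    unfolding jeu_de_taquin_def ends H_corners by auto
  assume "jeu_de_taquin k k' P Q T U"
  then obtain \<epsilon> \<epsilon>' where T: "tableau k \<epsilon> \<delta> T" and U: "tableau k' \<alpha> \<epsilon>' U"
    and eq: "filling_of U = filling_of (shapes k' (H 0))"
      "filling_of T = filling_of (shapes k (\<lambda>c. H c k'))"
    unfolding jeu_de_taquin_def ends jdt_fillings_grid by auto
  have "T ! c = H c k'" if "c \<le> k" for c
    using chain_eq_from_outer[OF tableau_chain[OF T] row _ _ that] eq(2) tableau_shapes[OF T]
      tableau_ends[OF T] H_corners by simp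
  moreover have "U ! s = H 0 s" if "s \<le> k'" for s
    using chain_eq_from_inner[OF tableau_chain[OF U] col _ _ that] eq(1) tableau_shapes[OF U]
      tableau_ends[OF U] H_corners by simp
  ultimately show "T = shapes k (\<lambda>c. H c k') \<and> U = shapes k' (H 0)"
    using tableau_shapes[OF T] tableau_shapes[OF U] shapes_cong by metis
qed

end

text \<open>The recursion counts columns from the right edge, because each column is pushed from its
  right neighbour, starting with Q.\<close>

primrec grid_from_right :: "partn list \<Rightarrow> partn list \<Rightarrow> nat \<Rightarrow> nat \<Rightarrow> nat \<Rightarrow> partn" where
  "grid_from_right P Q k 0 = (!) Q"
| "grid_from_right P Q k (Suc j) = push (P ! (k - Suc j)) (grid_from_right P Q k j)"

lemma switching_grid_exists:
  assumes "tableau k \<alpha> \<beta> P" "tableau k' \<beta> \<delta> Q"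
  shows "switching_grid k k' P Q \<alpha> \<beta> \<delta> (\<lambda>c. grid_from_right P Q k (k - c))"
proof
  fix c assume "c < k"
  then have "k - c = Suc (k - Suc c)" "k - Suc (k - Suc c) = c" by auto
  then show "grid_from_right P Q k (k - c) = push (P ! c) (grid_from_right P Q k (k - Suc c))"
    by simp
qed (use assms in simp_all)

subsection \<open>Internal row insertion\<close>

lemma prepend_simps:
  "start (prepend l n \<gamma>) = start \<gamma>"
  "part (prepend l n \<gamma>) r = (if r < start \<gamma> then 0 else if r < start \<gamma> + int n then l
     else part \<gamma> (r - int n))"
  by (simp_all add: prepend_def)

lemma prepend_prepend: "prepend l m (prepend l n \<gamma>) = prepend l (m + n) \<gamma>"
  by (rule partn_eqI) (auto simp: prepend_simps algebra_simps)

lemma support_prepend: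
  "{r. part (prepend l n \<gamma>) r \<noteq> 0} \<subseteq> {start \<gamma>..<start \<gamma> + int n} \<union> (\<lambda>i. i + int n) ` {i. part \<gamma> i \<noteq> 0}"
proof
  fix r assume "r \<in> {r. part (prepend l n \<gamma>) r \<noteq> 0}"
  then have "r \<in> {start \<gamma>..<start \<gamma> + int n} \<or> part \<gamma> (r - int n) \<noteq> 0"
    by (auto simp: prepend_simps split: if_splits)
  moreover have "r = (r - int n) + int n" by simp
  ultimately show "r \<in> {start \<gamma>..<start \<gamma> + int n} \<union> (\<lambda>i. i + int n) ` {i. part \<gamma> i \<noteq> 0}" by blast
qed

lemma is_partition_prepend:
  assumes "is_partition \<gamma>" "\<And>i. part \<gamma> i \<le> l"
  shows "is_partition (prepend l n \<gamma>)"
proof -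
  have "part \<gamma> (i + 1 - int n) \<le> part \<gamma> (i - int n)" if "start \<gamma> \<le> i - int n" for i
    using is_partition_antimono[OF assms(1), of "i - int n" "i + 1 - int n"] that by simp
  moreover have "finite {r. part (prepend l n \<gamma>) r \<noteq> 0}"
    by (rule finite_subset[OF support_prepend]) (use assms(1) in \<open>auto simp: is_partition_def\<close>)
  ultimately show ?thesis
    using assms(2) by (auto simp: is_partition_def prepend_simps)
qed

lemma strip_prepend:
  assumes "horizontal_strip \<alpha> \<beta>" "\<And>i. part \<beta> i \<le> l"
  shows "horizontal_strip (prepend l n \<alpha>) (prepend l n \<beta>)"
proof -
  note h = horizontal_stripD[OF assms(1)]
  have "part (prepend l n \<alpha>) i \<le> part (prepend l n \<beta>) i \<and>
      part (prepend l n \<beta>) (i + 1) \<le> part (prepend l n \<alpha>) i" if "start \<beta> \<le> i" for i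
    using h(2,3)[of "i - int n"] assms(2) that by (auto simp: prepend_simps h(1) algebra_simps)
  then show ?thesis by (simp add: horizontal_strip_def prepend_simps h(1))
qed

text \<open>Moving \<gamma> one row further down than \<alpha> reverses the interlacing: each part
  of \<gamma> is then compared with the next part of \<alpha>, and the extra l fills the freed row.
  This is why a complement is again a chain of strips.\<close>

lemma strip_prepend_Suc:
  assumes "horizontal_strip \<gamma> \<alpha>" "\<And>i. part \<alpha> i \<le> l"
  shows "horizontal_strip (prepend l n \<alpha>) (prepend l (Suc n) \<gamma>)"
proof -
  note h = horizontal_stripD[OF assms(1)]
  have g: "part \<gamma> i \<le> l" if "start \<alpha> \<le> i" for i using h(2)[OF that] assms(2)[of i] by simp
  have "part (prepend l n \<alpha>) i \<le> part (prepend l (Suc n) \<gamma>) i \<and>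
      part (prepend l (Suc n) \<gamma>) (i + 1) \<le> part (prepend l n \<alpha>) i" if "start \<alpha> \<le> i" for i
  proof (cases "i < start \<alpha> + int n")
    case True
    then show ?thesis using that g by (auto simp: prepend_simps h(1))
  next
    case False
    then have "i = start \<alpha> + int n \<or> start \<alpha> < i - int n" by linarith
    then show ?thesis
      using False that h(2,4)[of "i - int n"] assms(2)
      by (elim disjE) (auto simp: prepend_simps h(1) algebra_simps)
  qed
  then show ?thesis by (simp add: horizontal_strip_def prepend_simps h(1))
qed

text \<open>With one more l prepended in the lower row of the square, the local rule becomes the
  defining equation of \<open>bk\<close>, the prepended l playing the infinite part above the first
  row. At least one l is prepended everywhere, so that all initial parts equal l.\<close>

lemma local_square_bk:
  assumes g: "horizontal_strip \<gamma> \<delta>" "horizontal_strip \<delta> \<beta>" "is_partition \<beta>" "\<And>i. part \<beta> i \<le> l"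
  shows "local_square l (prepend l (Suc n) (bk \<gamma> \<delta> \<beta>)) (prepend l (Suc n) \<beta>)
    (prepend l (Suc (Suc n)) \<gamma>) (prepend l (Suc (Suc n)) \<delta>)"
proof -
  let ?a = "bk \<gamma> \<delta> \<beta>"
  note b = bk_strips[OF g(1-3)]
  have s: "start \<gamma> = start \<beta>" "start \<delta> = start \<beta>"
    using horizontal_stripD(1)[OF g(1)] horizontal_stripD(1)[OF g(2)] by simp_all
  have sa: "start ?a = start \<beta>" by (simp add: bk_simps s)
  have al: "part ?a i \<le> l" for i
    using horizontal_strip_le[OF b(2,3), of i] g(4)[of i] by simp
  have rule: "prepend l (Suc (Suc n)) \<delta> = local_rule l (prepend l (Suc n) ?a) (prepend l (Suc n) \<beta>)
    (prepend l (Suc (Suc n)) \<gamma>)"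
  proof (rule partn_eqI)
    show "start (prepend l (Suc (Suc n)) \<delta>) = start (local_rule l (prepend l (Suc n) ?a)
        (prepend l (Suc n) \<beta>) (prepend l (Suc (Suc n)) \<gamma>))"
      by (simp add: local_rule_def prepend_simps s sa)
    fix r
    show "part (prepend l (Suc (Suc n)) \<delta>) r = part (local_rule l (prepend l (Suc n) ?a)
        (prepend l (Suc n) \<beta>) (prepend l (Suc (Suc n)) \<gamma>)) r"
    proof (cases "r < start \<beta> + int (Suc (Suc n))")
      case True
      then show ?thesis
        using g(4) by (auto simp: local_rule_def prepend_simps s sa max_absorb2)
    next
      case False
      \<comment> \<open>q is the row of \<delta> that the lower right corner shows in row r. The
        local rule there refers to row r - 1 of the upper left corner, which is row q of
        \<open>bk\<close>.\<close>
      define q where "q = r - int (Suc (Suc n))"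
      have q: "start \<beta> \<le> q" and r: "r = q + int (Suc (Suc n))" using False by (auto simp: q_def)
      have "part ?a q + part \<delta> q = max (part \<beta> (1 + q)) (part \<gamma> q)
             + (if q = start \<gamma> then part \<beta> q else min (part \<beta> q) (part \<gamma> (q - 1)))"
        using bk_add[OF g(1,2)] q s by (simp add: add.commute)
      then have "part \<delta> q = max (part \<beta> (1 + q)) (part \<gamma> q)
             + (if q = start \<gamma> then part \<beta> q else min (part \<beta> q) (part \<gamma> (q - 1))) - part ?a q"
        by linarith
      then show ?thesis
        using q g(4)[of q] by (auto simp: local_rule_def prepend_simps s sa r)
    qed
  qed
  show ?thesis
    unfolding local_square_def
    using strip_prepend[OF b(2) g(4)] strip_prepend_Suc[OF b(1) al] rule
    by (simp add: initial_part_def prepend_simps)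
qed

lemma local_square_add:
  assumes "local_square l \<alpha> \<beta> \<gamma> \<delta>" "start \<alpha> \<le> i"
  shows "part \<alpha> i + part \<delta> (i + 1) = max (part \<beta> (i + 1)) (part \<gamma> (i + 1)) + min (part \<beta> i) (part \<gamma> i)"
proof -
  have h: "horizontal_strip \<alpha> \<beta>" "horizontal_strip \<alpha> \<gamma>" "\<delta> = local_rule l \<alpha> \<beta> \<gamma>"
    using assms(1) by (auto simp: local_square_def)
  have "part \<alpha> i \<le> part \<beta> i" "part \<alpha> i \<le> part \<gamma> i"
    using horizontal_stripD(1,2)[OF h(1)] horizontal_stripD(1,2)[OF h(2)] assms(2) by auto
  then show ?thesis using assms(2) by (simp add: h(3) local_rule_def)
qed

text \<open>Row r + 1 of the lower right corner can be solved for row r of A, so the local rule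
  fixes all rows from the start on. That A is a partition fixes the rows before the start as
  0.\<close>

lemma local_square_unique:
  assumes sq: "local_square l A (prepend l n \<beta>) (prepend l (Suc n) \<gamma>) (prepend l (Suc n) \<delta>)"
    and A: "is_partition A"
    and g: "horizontal_strip \<gamma> \<delta>" "horizontal_strip \<delta> \<beta>" "\<And>i. part \<beta> i \<le> l"
  shows "A = prepend l n (bk \<gamma> \<delta> \<beta>)"
proof (rule partn_eqI)
  let ?a = "bk \<gamma> \<delta> \<beta>"
  have s: "start \<gamma> = start \<beta>" "start \<delta> = start \<beta>"
    using horizontal_stripD(1)[OF g(1)] horizontal_stripD(1)[OF g(2)] by simp_all
  have sa: "start ?a = start \<beta>" by (simp add: bk_simps s)
  have "horizontal_strip A (prepend l n \<beta>)" using sq by (simp add: local_square_def)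
  then have sA: "start A = start \<beta>" using horizontal_stripD(1) by (fastforce simp: prepend_simps)
  then show "start A = start (prepend l n ?a)" by (simp add: prepend_simps sa)
  fix r
  show "part A r = part (prepend l n ?a) r"
  proof (cases "r < start \<beta>")
    case True
    then show ?thesis using is_partition_below[OF A] by (simp add: prepend_simps sa sA)
  next
    case False
    note add = local_square_add[OF sq, of r]
    show ?thesis
    proof (cases "r < start \<beta> + int n")
      case True
      \<comment> \<open>Inside the prepended block the rule reads
        \<open>part A r + l = l + l\<close>.\<close>
      then show ?thesis
        using False add g(3)[of "r + 1 - int n"] by (auto simp: prepend_simps s sa sA max_def split: if_splits)
    next
      case ge: False
      define q where "q = r - int n"
      have q: "start \<beta> \<le> q" and r: "r = q + int n" using ge by (auto simp: q_def)
      have "part ?a q + part \<delta> q = max (part \<beta> (q + 1)) (part \<gamma> q)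
             + (if q = start \<gamma> then part \<beta> q else min (part \<beta> q) (part \<gamma> (q - 1)))"
        using bk_add[OF g(1,2)] q s by simp
      moreover have "part A r + part \<delta> q = max (part \<beta> (q + 1)) (part \<gamma> q)
             + (if q = start \<gamma> then part \<beta> q else min (part \<beta> q) (part \<gamma> (q - 1)))"
        using add q min_absorb1[OF g(3)]
        by (auto simp: prepend_simps s sA r algebra_simps split: if_splits)
      ultimately show ?thesis using q by (simp add: prepend_simps sa r)
    qed
  qed
qed

section \<open>Sizes of shapes, used to compare contents\<close>

definition weight :: "partn \<Rightarrow> nat" where
  "weight \<gamma> = (\<Sum>i | part \<gamma> i \<noteq> 0. part \<gamma> i)"

lemma weight_superset:
  assumes "finite A" "{i. part \<gamma> i \<noteq> 0} \<subseteq> A"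
  shows "weight \<gamma> = (\<Sum>i\<in>A. part \<gamma> i)"
  unfolding weight_def using assms by (intro sum.mono_neutral_left) auto

lemma card_skew_boxes:
  assumes "\<And>i. part \<alpha> i \<le> part \<beta> i" "is_partition \<beta>"
  shows "card (skew_boxes \<alpha> \<beta>) + weight \<alpha> = weight \<beta>"
proof -
  let ?A = "{i. part \<beta> i \<noteq> 0}"
  have fin: "finite ?A" using assms(2) by (simp add: is_partition_def)
  have "skew_boxes \<alpha> \<beta> = Sigma ?A (\<lambda>i. {part \<alpha> i<..part \<beta> i})"
    by (auto simp: skew_boxes_def)
  then have "card (skew_boxes \<alpha> \<beta>) = (\<Sum>i\<in>?A. part \<beta> i - part \<alpha> i)"
    using fin by (simp add: card_SigmaI)
  moreover have "{i. part \<alpha> i \<noteq> 0} \<subseteq> ?A" using assms(1) by (auto intro: less_le_trans)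
  ultimately show ?thesis
    using assms(1) weight_superset[OF fin, of \<alpha>]
    by (simp add: weight_def sum.distrib[symmetric])
qed

lemma weight_prepend:
  assumes "is_partition \<gamma>"
  shows "weight (prepend l n \<gamma>) = n * l + weight \<gamma>"
proof -
  let ?S = "{i. part \<gamma> i \<noteq> 0}" and ?I = "{start \<gamma>..<start \<gamma> + int n}" and ?f = "\<lambda>i. i + int n"
  have fin: "finite ?S" using assms by (simp add: is_partition_def)
  have ge: "start \<gamma> \<le> i" if "i \<in> ?S" for i
    using that is_partition_below[OF assms, of i] by (cases "i < start \<gamma>") auto
  have "weight (prepend l n \<gamma>) = (\<Sum>r\<in>?I \<union> ?f ` ?S. part (prepend l n \<gamma>) r)"
    using fin support_prepend by (intro weight_superset) auto
  also have "\<dots> = (\<Sum>r\<in>?I. part (prepend l n \<gamma>) r) + (\<Sum>r\<in>?f ` ?S. part (prepend l n \<gamma>) r)"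
    using fin ge by (intro sum.union_disjoint) fastforce+
  also have "(\<Sum>r\<in>?I. part (prepend l n \<gamma>) r) = n * l"
    by (simp add: prepend_simps)
  also have "(\<Sum>r\<in>?f ` ?S. part (prepend l n \<gamma>) r) = (\<Sum>i\<in>?S. part (prepend l n \<gamma>) (?f i))"
    by (subst sum.reindex) (auto simp: inj_on_def)
  also have "\<dots> = weight \<gamma>"
  proof -
    have "part (prepend l n \<gamma>) (?f i) = part \<gamma> i" if "i \<in> ?S" for i
      using ge[OF that] by (simp add: prepend_simps)
    then show ?thesis unfolding weight_def by (intro sum.cong refl)
  qed
  finally show ?thesis .
qed

text \<open>Stated for all sufficiently large n, so that several partitions can share one summation
  range.\<close>

lemma weight_rows:
  assumes "is_partition \<gamma>"
  shows "\<exists>N. \<forall>n\<ge>N. weight \<gamma> = (\<Sum>j<n. part \<gamma> (start \<gamma> + int j)) \<and> part \<gamma> (start \<gamma> + int n) = 0"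
proof -
  let ?S = "{i. part \<gamma> i \<noteq> 0}"
  have fin: "finite ?S" using assms by (simp add: is_partition_def)
  have ge: "start \<gamma> \<le> i" if "part \<gamma> i \<noteq> 0" for i
    using that is_partition_below[OF assms, of i] by (cases "i < start \<gamma>") auto
  define N where "N = nat (Max (insert (start \<gamma>) ?S) + 1 - start \<gamma>)"
  have N: "i < start \<gamma> + int N" if "part \<gamma> i \<noteq> 0" for i
  proof -
    have "i \<le> Max (insert (start \<gamma>) ?S)" "start \<gamma> \<le> Max (insert (start \<gamma>) ?S)"
      using fin that by (intro Max_ge; simp)+
    then show ?thesis unfolding N_def by linarith
  qed
  have "weight \<gamma> = (\<Sum>j<n. part \<gamma> (start \<gamma> + int j)) \<and> part \<gamma> (start \<gamma> + int n) = 0" if "N \<le> n" for n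
  proof
    have inj: "inj_on (\<lambda>j. start \<gamma> + int j) {..<n}" by (auto simp: inj_on_def)
    have "i \<in> (\<lambda>j. start \<gamma> + int j) ` {..<n}" if "part \<gamma> i \<noteq> 0" for i
      using ge[OF that] N[OF that] \<open>N \<le> n\<close> by (intro image_eqI[of _ _ "nat (i - start \<gamma>)"]) auto
    then have "weight \<gamma> = (\<Sum>i\<in>(\<lambda>j. start \<gamma> + int j) ` {..<n}. part \<gamma> i)"
      by (intro weight_superset) auto
    then show "weight \<gamma> = (\<Sum>j<n. part \<gamma> (start \<gamma> + int j))"
      by (simp add: sum.reindex[OF inj])
    show "part \<gamma> (start \<gamma> + int n) = 0" using N[of "start \<gamma> + int n"] that by auto
  qed
  then show ?thesis by blast
qed

text \<open>Summing \<open>bk_add\<close> over the rows telescopes: the \<open>max\<close> of a row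
  and the \<open>min\<close> of the next row involve the same two parts and add up to their
  sum.\<close>

lemma weight_bk:
  assumes g: "horizontal_strip \<gamma> \<delta>" "horizontal_strip \<delta> \<beta>"
    and p: "is_partition \<gamma>" "is_partition \<delta>" "is_partition \<beta>"
  shows "weight (bk \<gamma> \<delta> \<beta>) + weight \<delta> = weight \<beta> + weight \<gamma>"
proof -
  let ?a = "bk \<gamma> \<delta> \<beta>" and ?m = "start \<beta>"
  have s: "start \<gamma> = ?m" "start \<delta> = ?m" "start ?a = ?m"
    using horizontal_stripD(1)[OF g(1)] horizontal_stripD(1)[OF g(2)] by (simp_all add: bk_simps)
  obtain N1 where N1: "\<And>n. n \<ge> N1 \<Longrightarrow> weight ?a = (\<Sum>j<n. part ?a (?m + int j))"
    using weight_rows[OF bk_strips(3)[OF g p(3)]] s by metis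
  obtain N2 where N2: "\<And>n. n \<ge> N2 \<Longrightarrow> weight \<delta> = (\<Sum>j<n. part \<delta> (?m + int j))"
    using weight_rows[OF p(2)] s by metis
  obtain N3 where N3: "\<And>n. n \<ge> N3 \<Longrightarrow> weight \<gamma> = (\<Sum>j<n. part \<gamma> (?m + int j))"
    using weight_rows[OF p(1)] s by metis
  obtain N4 where N4: "\<And>n. n \<ge> N4 \<Longrightarrow> weight \<beta> = (\<Sum>j<n. part \<beta> (?m + int j)) \<and> part \<beta> (?m + int n) = 0"
    using weight_rows[OF p(3)] s by metis
  \<comment> \<open>The \<open>min\<close> terms, with the convention of an infinite part above the
    first row. The leftover h n in the partial sums vanishes together with the part of \<beta> once
    n is large.\<close>
  define h where "h j = (if j = 0 then part \<beta> ?m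
      else min (part \<beta> (?m + int j)) (part \<gamma> (?m + int j - 1)))" for j
  have "(\<Sum>j<n. part ?a (?m + int j)) + (\<Sum>j<n. part \<delta> (?m + int j)) + h n =
      (\<Sum>j<n. part \<beta> (?m + int j)) + (\<Sum>j<n. part \<gamma> (?m + int j)) + part \<beta> (?m + int n)" for n
  proof (induction n)
    case 0
    then show ?case by (simp add: h_def)
  next
    case (Suc n)
    have "part ?a (?m + int n) + part \<delta> (?m + int n) =
        max (part \<beta> (?m + int n + 1)) (part \<gamma> (?m + int n)) + h n"
      using bk_add[OF g, of "?m + int n"] s by (auto simp: h_def)
    moreover have "h (Suc n) = min (part \<beta> (?m + int n + 1)) (part \<gamma> (?m + int n))"
      by (simp add: h_def ac_simps)
    moreover have "part \<beta> (?m + int (Suc n)) = part \<beta> (?m + int n + 1)" by (simp add: ac_simps)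
    ultimately show ?case using Suc unfolding sum.lessThan_Suc by linarith
  qed
  moreover define n where "n = N1 + N2 + N3 + N4"
  ultimately have "weight ?a + weight \<delta> + h n = weight \<beta> + weight \<gamma> + part \<beta> (?m + int n)"
    using N1[of n] N2[of n] N3[of n] N4[of n] by simp
  moreover have "part \<beta> (?m + int n) = 0" using N4[of n] by (simp add: n_def)
  moreover from this have "h n = 0" by (auto simp: h_def)
  ultimately show ?thesis by simp
qed

section \<open>The array of shapes as a growth diagram\<close>

lemma content_shapes:
  "content (shapes k C) = map (\<lambda>i. card (skew_boxes (C i) (C (Suc i)))) [0..<k]"
  by (auto simp: content_def length_shapes nth_shapes)

lemma array_row_shapes: "array_row k G r = shapes k (G r)"
  by (simp add: array_row_def shapes_def)

lemma array_col_shapes: "array_col k' G c = shapes k' (\<lambda>r. G r c)"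
  by (simp add: array_col_def shapes_def)

lemma shapes_eqD: "shapes k C = shapes k D \<Longrightarrow> s \<le> k \<Longrightarrow> C s = D s"
  using nth_shapes by metis

lemma prepend_tableau_shapes: "prepend_tableau l n (shapes k C) = shapes k (\<lambda>s. prepend l n (C s))"
  by (simp add: prepend_tableau_def shapes_def)

lemma complement_shapes: "complement k l (shapes k C) = shapes k (\<lambda>s. prepend l s (C (k - s)))"
  unfolding complement_def shapes_def[of k "\<lambda>s. prepend l s (C (k - s))"]
  by (auto simp: nth_shapes)

context switching_grid
begin

lemma H_le:
  assumes "initial_part \<delta> \<le> l" "c \<le> k" "s \<le> k'"
  shows "part (H c s) i \<le> l"
proof -
  have \<delta>: "is_partition \<delta>"
    using chain_col[of k] H_corners by (auto simp: chain_def)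
  have "part (H c s) i \<le> part (H k s) i"
    using chain_mono[OF chain_row[OF assms(3)] assms(2)] by simp
  also have "\<dots> \<le> part \<delta> i"
    using chain_mono[OF chain_col[OF order_refl] assms(3)] H_corners by simp
  also have "\<dots> \<le> l"
  proof (cases "i < start \<delta>")
    case False
    then show ?thesis
      using is_partition_antimono[OF \<delta> order_refl, of i] assms(1) by (simp add: initial_part_def)
  qed (use is_partition_below[OF \<delta>] in simp)
  finally show ?thesis .
qed

lemma H_partition: "c \<le> k \<Longrightarrow> s \<le> k' \<Longrightarrow> is_partition (H c s)"
  using chain_col by (simp add: chain_def)

lemma strip_col: "c \<le> k \<Longrightarrow> s < k' \<Longrightarrow> horizontal_strip (H c s) (H c (Suc s))"
  using chain_col by (simp add: chain_def)

text \<open>Opposite sides of a square differ in size by the same number of boxes. Iterated along a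
  column or a row, this makes the contents of all rows, and of all columns, equal.\<close>

lemma weight_H:
  assumes "c < k" "s < k'"
  shows "weight (H c (Suc s)) + weight (H (Suc c) s) = weight (H (Suc c) (Suc s)) + weight (H c s)"
  unfolding H_bk[OF assms(1)]
  using assms by (intro weight_bk strip_row strip_col H_partition) auto

lemma weight_H_row:
  assumes "c < k" "s \<le> k'"
  shows "weight (H (Suc c) s) + weight (H c 0) = weight (H c s) + weight (H (Suc c) 0)"
  using assms(2)
proof (induction s)
  case (Suc s)
  then show ?case using weight_H[OF assms(1), of s] by simp
qed simp

lemma weight_H_col:
  assumes "s < k'" "c \<le> k"
  shows "weight (H c (Suc s)) + weight (H 0 s) = weight (H c s) + weight (H 0 (Suc s))"
  using assms(2)
proof (induction c)
  case (Suc c)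
  then show ?case using weight_H[OF _ assms(1), of c] by simp
qed simp

lemma row_insertion_exists:
  assumes l: "initial_part \<delta> \<le> l"
  shows "\<exists>T U. row_insertion l k k' (prepend_tableau l k' P) (complement k' l Q) T U"
proof -
  \<comment> \<open>The array H turned upside down, as rows of a growth diagram run from top to
    bottom. Row r has r prepended parts from the complement and one more to make all initial parts
    l.\<close>
  define G where "G r c = prepend l (Suc r) (H c (k' - r))" for r c
  note le = H_le[OF l]
  have part_G: "is_partition (G r c)" if "c \<le> k" for r c
    unfolding G_def using that le H_partition by (intro is_partition_prepend) auto
  have row: "horizontal_strip (G r c) (G r (Suc c))" if "c < k" for r c
    unfolding G_def using that le strip_row by (intro strip_prepend) auto
  have Suc_diff: "k' - r = Suc (k' - Suc r)" if "r < k'" for r using that by simp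
  have col: "horizontal_strip (G r c) (G (Suc r) c)" if "c \<le> k" "r < k'" for r c
    unfolding G_def Suc_diff[OF that(2)]
    by (rule strip_prepend_Suc) (use that le strip_col in auto)
  have rows: "chain k (G r)" for r using part_G row by (simp add: chain_def)
  have cols: "chain k' (\<lambda>r. G r c)" if "c \<le> k" for c
    using part_G col that by (simp add: chain_def)
  have wG: "weight (G r c) = Suc r * l + weight (H c (k' - r))" if "c \<le> k" for r c
    unfolding G_def using that H_partition by (intro weight_prepend) auto
  have card_row: "card (skew_boxes (G r c) (G r (Suc c))) + weight (H c 0) = weight (H (Suc c) 0)"
    if "c < k" for r c
    using card_skew_boxes[OF horizontal_strip_le[OF row[OF that] part_G] part_G, of r]
      wG[of c r] wG[of "Suc c" r] weight_H_row[of c "k' - r"] that by simp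
  \<comment> \<open>The extra prepended part contributes l boxes in every column, so the count does
    not depend on c.\<close>
  have card_col: "card (skew_boxes (G r c) (G (Suc r) c)) + weight (H 0 (k' - r)) =
      l + weight (H 0 (k' - Suc r))" if "c \<le> k" "r < k'" for r c
    using card_skew_boxes[OF horizontal_strip_le[OF col[OF that] part_G] part_G]
      wG[of c r] wG[of c "Suc r"] weight_H_col[of "k' - Suc r" c] Suc_diff[OF that(2)] that by simp
  have "growth_diagram k k' G"
    unfolding growth_diagram_def array_row_shapes array_col_shapes content_shapes
  proof (intro conjI allI impI)
    show "tableau k (G r 0) (G r k) (shapes k (G r))" for r by (rule chain_tableau[OF rows])
    show "tableau k' (G 0 c) (G k' c) (shapes k' (\<lambda>r. G r c))" if "c \<le> k" for c
      by (rule chain_tableau[OF cols[OF that]])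
    show "map (\<lambda>c. card (skew_boxes (G r c) (G r (Suc c)))) [0..<k] =
        map (\<lambda>c. card (skew_boxes (G 0 c) (G 0 (Suc c)))) [0..<k]" for r
      by (intro map_cong refl add_right_imp_eq[OF trans[OF card_row card_row[symmetric]]]) auto
    show "map (\<lambda>r. card (skew_boxes (G r c) (G (Suc r) c))) [0..<k'] =
        map (\<lambda>r. card (skew_boxes (G r 0) (G (Suc r) 0))) [0..<k']" if "c \<le> k" for c
      using that
      by (intro map_cong refl add_right_imp_eq[OF trans[OF card_col card_col[symmetric]]]) auto
  qed
  moreover have "local_square l (G r c) (G r (Suc c)) (G (Suc r) c) (G (Suc r) (Suc c))"
    if "r < k'" "c < k" for r c
    unfolding G_def Suc_diff[OF that(1)] H_bk[OF that(2)]
    by (rule local_square_bk) (use that le strip_row strip_col H_partition in auto)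
  moreover have "array_row k G k' = prepend_tableau l 1 (prepend_tableau l k' P)"
    unfolding array_row_shapes
    by (subst tableau_shapes[OF P])
      (auto simp: prepend_tableau_shapes prepend_prepend G_def H_0 intro!: shapes_cong)
  moreover have "array_col k' G k = prepend_tableau l 1 (complement k' l Q)"
    unfolding array_col_shapes
    by (subst tableau_shapes[OF Q])
      (auto simp: prepend_tableau_shapes complement_shapes prepend_prepend G_def H_last
        intro!: shapes_cong)
  ultimately show ?thesis unfolding row_insertion_def by blast
qed

text \<open>Every admissible diagram agrees with the array H up to prepended parts: its last row and
  column are prescribed, and \<open>local_square_unique\<close> fixes the other shapes from the
  lower right corner on. The number n of prepended parts remains free.\<close>

lemma row_insertion_grid:
  assumes l: "initial_part \<delta> \<le> l"
    and ri: "row_insertion l k k' (prepend_tableau l k' P) (complement k' l Q) T U"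
  shows "\<exists>n. T = shapes k (\<lambda>c. prepend l n (H c k')) \<and>
    U = shapes k' (\<lambda>r. prepend l (n + r) (H 0 (k' - r)))"
proof -
  note le = H_le[OF l]
  obtain n G where G: "growth_diagram k k' G"
    and sq: "\<And>r c. r < k' \<Longrightarrow> c < k \<Longrightarrow>
      local_square l (G r c) (G r (Suc c)) (G (Suc r) c) (G (Suc r) (Suc c))"
    and r: "array_row k G k' = prepend_tableau l n (prepend_tableau l k' P)"
    and c: "array_col k' G k = prepend_tableau l n (complement k' l Q)"
    and T: "T = array_row k G 0" and U: "U = array_col k' G 0"
    using ri unfolding row_insertion_def by blast
  have part_G: "is_partition (G r c)" if "r \<le> k'" "c \<le> k" for r c
  proof -
    have "tableau k (G r 0) (G r k) (shapes k (G r))"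
      using G that unfolding growth_diagram_def array_row_shapes by blast
    from tableau_chain[OF this] that nth_shapes[of c k "G r"] show ?thesis
      unfolding chain_def by metis
  qed
  have last_row: "G k' c = prepend l (n + k') (P ! c)" if "c \<le> k" for c
  proof -
    have "prepend_tableau l k' P = shapes k (\<lambda>c. prepend l k' (P ! c))"
      using prepend_tableau_shapes[of l k' k "(!) P"] tableau_shapes[OF P] by simp
    then have "shapes k (G k') = shapes k (\<lambda>c. prepend l (n + k') (P ! c))"
      using r by (simp add: array_row_shapes prepend_tableau_shapes prepend_prepend)
    from shapes_eqD[OF this that] show ?thesis .
  qed
  have last_col: "G r k = prepend l (n + r) (Q ! (k' - r))" if "r \<le> k'" for r
  proof -
    have "complement k' l Q = shapes k' (\<lambda>s. prepend l s (Q ! (k' - s)))"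
      using complement_shapes[of k' l "(!) Q"] tableau_shapes[OF Q] by simp
    then have "shapes k' (\<lambda>r. G r k) = shapes k' (\<lambda>r. prepend l (n + r) (Q ! (k' - r)))"
      using c by (simp add: array_col_shapes prepend_tableau_shapes prepend_prepend)
    from shapes_eqD[OF this that] show ?thesis .
  qed
  \<comment> \<open>The outer induction goes up the rows from the last one, the inner one leftwards
    from the last column.\<close>
  have "\<forall>c\<le>k. G r c = prepend l (n + r) (H c (k' - r))" if "r \<le> k'" for r
    using that
  proof (induction r rule: inc_induct)
    case base
    then show ?case using last_row H_0 by simp
  next
    case (step r)
    have Suc_diff: "k' - r = Suc (k' - Suc r)" using step.hyps by simp
    have "G r c = prepend l (n + r) (H c (k' - r))" if "c \<le> k" for c
      using that
    proof (induction c rule: inc_induct)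
      case base
      then show ?case using last_col[of r] step.hyps H_last by simp
    next
      case (step c)
      note outer = \<open>r < k'\<close> \<open>\<forall>c\<le>k. G (Suc r) c = prepend l (n + Suc r) (H c (k' - Suc r))\<close>
      have "local_square l (G r c) (prepend l (n + r) (H (Suc c) (k' - r)))
        (prepend l (Suc (n + r)) (H c (k' - Suc r))) (prepend l (Suc (n + r)) (H (Suc c) (k' - Suc r)))"
        using sq[OF outer(1) step.hyps(2)] step outer(2) by simp
      then show ?case
        unfolding Suc_diff H_bk[OF step.hyps(2)]
        by (rule local_square_unique) (use step.hyps outer le strip_row strip_col part_G in auto)
    qed
    then show ?case by blast
  qed
  then have "G 0 c = prepend l n (H c k')" "G r 0 = prepend l (n + r) (H 0 (k' - r))"
    if "c \<le> k" "r \<le> k'" for r c using that by auto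
  then show ?thesis
    unfolding T U array_row_shapes array_col_shapes
    by (intro exI[of _ n] conjI shapes_cong) auto
qed

end

theorem theorem4p2:
  fixes P Q :: "partn list" and \<alpha> \<beta> \<delta> :: partn and k k' l :: nat
  assumes "tableau k \<alpha> \<beta> P"
    and "tableau k' \<beta> \<delta> Q"
    and "initial_part \<delta> \<le> l"
  shows "last (prepend_tableau l k' P) = prepend l k' \<beta>
       \<and> last (complement k' l Q) = prepend l k' \<beta>
       \<and> (\<exists>T U. jeu_de_taquin k k' P Q T U)
       \<and> (\<exists>T' U'. row_insertion l k k' (prepend_tableau l k' P) (complement k' l Q) T' U')
       \<and> (\<forall>T U T' U'.
            jeu_de_taquin k k' P Q T U \<longrightarrow>
            row_insertion l k k' (prepend_tableau l k' P) (complement k' l Q) T' U' \<longrightarrow>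
            vshift_eq l T T' \<and> vshift_eq l U (complement k' l U'))"
proof -
  define H where "H c = grid_from_right P Q k (k - c)" for c
  interpret switching_grid k k' P Q \<alpha> \<beta> \<delta> H
    unfolding H_def by (rule switching_grid_exists[OF assms(1,2)])
  have "P \<noteq> []" "last P = \<beta>" using P by (auto simp: tableau_def)
  then have 1: "last (prepend_tableau l k' P) = prepend l k' \<beta>"
    by (simp add: prepend_tableau_def last_map)
  have 2: "last (complement k' l Q) = prepend l k' \<beta>"
    using tableau_ends(1)[OF Q] by (simp add: complement_def)
  have 3: "\<exists>T U. jeu_de_taquin k k' P Q T U" by (simp add: jeu_de_taquin_grid)
  have 4: "vshift_eq l T T' \<and> vshift_eq l U (complement k' l U')"
    if jdt: "jeu_de_taquin k k' P Q T U"
      and ri: "row_insertion l k k' (prepend_tableau l k' P) (complement k' l Q) T' U'" for T U T' U'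
  proof -
    have T: "T = shapes k (\<lambda>c. H c k')" and U: "U = shapes k' (H 0)"
      using jdt by (simp_all add: jeu_de_taquin_grid)
    obtain n where T': "T' = shapes k (\<lambda>c. prepend l n (H c k'))"
      and U': "U' = shapes k' (\<lambda>r. prepend l (n + r) (H 0 (k' - r)))"
      using row_insertion_grid[OF assms(3) ri] by blast
    \<comment> \<open>T' carries n extra parts. In the complement of U' the shape at index s
      receives s parts on top of the n + (k' - s) already there, so the shift is n + k' for every
      s.\<close>
    have "prepend_tableau l n T = prepend_tableau l 0 T'"
      by (simp add: T T' prepend_tableau_shapes prepend_prepend)
    moreover have "prepend_tableau l (n + k') U = prepend_tableau l 0 (complement k' l U')"
      unfolding U U' complement_shapes prepend_tableau_shapes
      by (intro shapes_cong) (auto simp: prepend_prepend intro!: arg_cong2[of _ _ _ _ "prepend l"])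
    ultimately show ?thesis unfolding vshift_eq_def by blast
  qed
  show ?thesis using 1 2 3 row_insertion_exists[OF assms(3)] 4 by blast
qed

end
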